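(* The Parikh coverability problem is undecidable for asynchronous QDAS with at least one serial queue.
   Context: A queue-dispatch asynchronous system (QDAS) $\mathcal A$ consists of: a finite data domain $\mathbb D$ with an initial value $d_0$; a finite set $\mathcal X$ of variables ranging over $\mathbb D$; disjoint finite sets $CQID$ (concurrent queues) and $SQID$ (serial queues); a finite set $\Gamma$ of blocks with a distinguished initial block $main$; and for each block $\gamma\in\Gamma$ a finite labelled transition system with state set $S_\gamma$, initial state $s^0_\gamma$, a distinguished final state $f_\gamma\in S_\gamma$, and transitions $\Delta_\gamma\subseteq S_\gamma\times\Sigma\times S_\gamma$. The state sets are pairwise disjoint and $S=\bigcup_\gamma S_\gamma$. The actions $\Sigma$ are: asynchronous dispatches $\mathrm{dispatch_a}(q,\gamma)$ and synchronous dispatches $\mathrm{dispatch_s}(q,\gamma)$ with $q\in CQID\cup SQID$, $\gamma\in\Gamma\setminus\{main\}$; guards (finite conjunctions of atoms $x=d$, $x\neq d$); and assignments $x\gets d$. A configuration is a pair $(G,\mathbf d)$ of a valuation $\mathbf d:\mathcal X\to\mathbb D$ and a call-task graph $G$: a finite set of vertices, each being either a call vertex (a dispatched block waiting in a queue) or a task vertex (a running instance of a block), each labelled with a block $\lambda(v)$, the queue it was dispatched to (or a special identifier for $main$), and a state $state(v)\in S_{\lambda(v)}$ (call vertices carry the initial state of their block); the call vertices of each queue are ordered FIFO; and wait edges, where a wait edge $v\to w$ means $v$ is blocked until $w$ is removed. A task vertex is unblocked if it has no outgoing wait edge. The initial configuration has a single task vertex for $main$ in $s^0_{main}$ and all variables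 equal to $d_0$. Steps: an unblocked task vertex $v$ in state $s$ with $(s,a,s')\in\Delta_{\lambda(v)}$ moves to $s'$, where: a guard $a$ must be satisfied by $\mathbf d$; an assignment updates $\mathbf d$; $\mathrm{dispatch_a}(q,\gamma)$ appends a new call vertex for $\gamma$ at the end of queue $q$; $\mathrm{dispatch_s}(q,\gamma)$ does the same and adds a wait edge from $v$ to the new vertex. Scheduler steps: remove an unblocked task vertex $v$ with $state(v)=f_{\lambda(v)}$ (together with wait edges into it); turn the first call vertex of a concurrent queue into a task vertex; turn the first call vertex of a serial queue $q$ into a task vertex provided no task previously dequeued from $q$ is still present (so at most one task from a serial queue runs at a time). A configuration is reachable if it is obtained from the initial one by finitely many steps. The Parikh image $\mathrm{Parikh}(G):S\to\mathbb N$ maps $s$ to the number of vertices $v$ of $G$ with $state(v)=s$. The Parikh coverability problem: given a QDAS $\mathcal A$ and $f:S\to\mathbb N$, decide whether some reachable $(G,\mathbf d)$ satisfies $f(s)\le\mathrm{Parikh}(G)(s)$ for all $s\in S$. A QDAS is asynchronous if no transition is labelled by a synchronous dispatch. *)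

theory Defs
  imports Main "HOL-Library.Nat_Bijection"
begin

section \<open>Queue-dispatch asynchronous systems\<close>

datatype ('d, 'x) atom = Eq 'x 'd | Neq 'x 'd

text \<open>A guard is the conjunction of the listed atoms.\<close>

datatype ('d, 'x, 'q, 'b) action =
    DispatchA 'q 'b
  | DispatchS 'q 'b
  | Guard "('d, 'x) atom list"
  | Assign 'x 'd

record ('d, 'x, 'q, 'b, 's) qdas =
  Dom :: "'d set"
  dinit :: 'd
  Vars :: "'x set"
  CQID :: "'q set"
  SQID :: "'q set"
  Blocks :: "'b set"
  main :: 'b
  States :: "'b \<Rightarrow> 's set"
  sinit :: "'b \<Rightarrow> 's"
  sfinal :: "'b \<Rightarrow> 's"
  Delta :: "'b \<Rightarrow> ('s \<times> ('d, 'x, 'q, 'b) action \<times> 's) set"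

definition all_states :: "('d, 'x, 'q, 'b, 's) qdas \<Rightarrow> 's set" where
  "all_states A = (\<Union>\<gamma>\<in>Blocks A. States A \<gamma>)"

fun atom_over :: "('d, 'x, 'q, 'b, 's) qdas \<Rightarrow> ('d, 'x) atom \<Rightarrow> bool" where
  "atom_over A (Eq x d) \<longleftrightarrow> x \<in> Vars A \<and> d \<in> Dom A"
| "atom_over A (Neq x d) \<longleftrightarrow> x \<in> Vars A \<and> d \<in> Dom A"

fun action_over :: "('d, 'x, 'q, 'b, 's) qdas \<Rightarrow> ('d, 'x, 'q, 'b) action \<Rightarrow> bool" where
  "action_over A (DispatchA q \<gamma>) \<longleftrightarrow> q \<in> CQID A \<union> SQID A \<and> \<gamma> \<in> Blocks A - {main A}"
| "action_over A (DispatchS q \<gamma>) \<longleftrightarrow> q \<in> CQID A \<union> SQID A \<and> \<gamma> \<in> Blocks A - {main A}"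
| "action_over A (Guard as) \<longleftrightarrow> (\<forall>a\<in>set as. atom_over A a)"
| "action_over A (Assign x d) \<longleftrightarrow> x \<in> Vars A \<and> d \<in> Dom A"

definition is_qdas :: "('d, 'x, 'q, 'b, 's) qdas \<Rightarrow> bool" where
  "is_qdas A \<longleftrightarrow>
     finite (Dom A) \<and> dinit A \<in> Dom A \<and> finite (Vars A) \<and>
     finite (CQID A) \<and> finite (SQID A) \<and> CQID A \<inter> SQID A = {} \<and>
     finite (Blocks A) \<and> main A \<in> Blocks A \<and>
     (\<forall>\<gamma>\<in>Blocks A. \<forall>\<gamma>'\<in>Blocks A. \<gamma> \<noteq> \<gamma>' \<longrightarrow> States A \<gamma> \<inter> States A \<gamma>' = {}) \<and>
     (\<forall>\<gamma>\<in>Blocks A.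
        finite (States A \<gamma>) \<and> sinit A \<gamma> \<in> States A \<gamma> \<and> sfinal A \<gamma> \<in> States A \<gamma> \<and>
        finite (Delta A \<gamma>) \<and>
        (\<forall>(s, a, s') \<in> Delta A \<gamma>. s \<in> States A \<gamma> \<and> action_over A a \<and> s' \<in> States A \<gamma>))"

definition asynchronous :: "('d, 'x, 'q, 'b, 's) qdas \<Rightarrow> bool" where
  "asynchronous A \<longleftrightarrow>
     (\<forall>\<gamma>\<in>Blocks A. \<forall>(s, a, s') \<in> Delta A \<gamma>. \<forall>q \<gamma>'. a \<noteq> DispatchS q \<gamma>')"

section \<open>Call-task graphs and the step relation\<close>

text \<open>
  Vertices are natural numbers. The call vertices are exactly the entries of the lists
  \<open>fifo q\<close>, whose head is the first vertex of the queue. The label \<open>queue v\<close> is the queue to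
  which the vertex was dispatched and persists when the call becomes a task; it is \<open>None\<close> for
  the vertex of the main block. Labels of numbers that are not vertices are irrelevant.
\<close>

record ('q, 'b, 's) ctg =
  tasks :: "nat set"
  fifo :: "'q \<Rightarrow> nat list"
  block :: "nat \<Rightarrow> 'b"
  queue :: "nat \<Rightarrow> 'q option"
  state :: "nat \<Rightarrow> 's"
  waits :: "(nat \<times> nat) set"

definition verts :: "('q, 'b, 's) ctg \<Rightarrow> nat set" where
  "verts G = tasks G \<union> (\<Union>q. set (fifo G q))"

definition unblocked :: "('q, 'b, 's) ctg \<Rightarrow> nat \<Rightarrow> bool" where
  "unblocked G v \<longleftrightarrow> (\<forall>w. (v, w) \<notin> waits G)"

definition enqueue ::
  "('d, 'x, 'q, 'b, 's) qdas \<Rightarrow> 'q \<Rightarrow> 'b \<Rightarrow> nat \<Rightarrow> ('q, 'b, 's) ctg \<Rightarrow> ('q, 'b, 's) ctg" where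
  "enqueue A q \<gamma> w G = G\<lparr>
     fifo := (fifo G)(q := fifo G q @ [w]),
     block := (block G)(w := \<gamma>),
     queue := (queue G)(w := Some q),
     state := (state G)(w := sinit A \<gamma>)\<rparr>"

definition move :: "nat \<Rightarrow> 's \<Rightarrow> ('q, 'b, 's) ctg \<Rightarrow> ('q, 'b, 's) ctg" where
  "move v s G = G\<lparr>state := (state G)(v := s)\<rparr>"

fun holds :: "('x \<Rightarrow> 'd) \<Rightarrow> ('d, 'x) atom \<Rightarrow> bool" where
  "holds val (Eq x d) \<longleftrightarrow> val x = d"
| "holds val (Neq x d) \<longleftrightarrow> val x \<noteq> d"

type_synonym ('d, 'x, 'q, 'b, 's) config = "('q, 'b, 's) ctg \<times> ('x \<Rightarrow> 'd)"

definition can_fire ::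
  "('d, 'x, 'q, 'b, 's) qdas \<Rightarrow> ('q, 'b, 's) ctg \<Rightarrow> nat \<Rightarrow> ('d, 'x, 'q, 'b) action \<Rightarrow> 's \<Rightarrow> bool"
where
  "can_fire A G v a s' \<longleftrightarrow>
     v \<in> tasks G \<and> unblocked G v \<and> (state G v, a, s') \<in> Delta A (block G v)"

inductive step ::
  "('d, 'x, 'q, 'b, 's) qdas \<Rightarrow> ('d, 'x, 'q, 'b, 's) config \<Rightarrow> ('d, 'x, 'q, 'b, 's) config \<Rightarrow> bool"
  for A
where
  guard: "can_fire A G v (Guard as) s' \<Longrightarrow> \<forall>a\<in>set as. holds val a \<Longrightarrow>
    step A (G, val) (move v s' G, val)"
| assign: "can_fire A G v (Assign x d) s' \<Longrightarrow>
    step A (G, val) (move v s' G, val(x := d))"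
| dispatch_a: "can_fire A G v (DispatchA q \<gamma>) s' \<Longrightarrow> w \<notin> verts G \<Longrightarrow>
    step A (G, val) (enqueue A q \<gamma> w (move v s' G), val)"
| dispatch_s: "can_fire A G v (DispatchS q \<gamma>) s' \<Longrightarrow> w \<notin> verts G \<Longrightarrow>
    step A (G, val) ((enqueue A q \<gamma> w (move v s' G))\<lparr>waits := insert (v, w) (waits G)\<rparr>, val)"
| finish: "v \<in> tasks G \<Longrightarrow> unblocked G v \<Longrightarrow> state G v = sfinal A (block G v) \<Longrightarrow>
    step A (G, val)
      (G\<lparr>tasks := tasks G - {v}, waits := {e \<in> waits G. snd e \<noteq> v}\<rparr>, val)"
| start_concurrent: "q \<in> CQID A \<Longrightarrow> fifo G q = w # ws \<Longrightarrow>
    step A (G, val) (G\<lparr>tasks := insert w (tasks G), fifo := (fifo G)(q := ws)\<rparr>, val)"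
| start_serial: "q \<in> SQID A \<Longrightarrow> fifo G q = w # ws \<Longrightarrow> \<forall>u\<in>tasks G. queue G u \<noteq> Some q \<Longrightarrow>
    step A (G, val) (G\<lparr>tasks := insert w (tasks G), fifo := (fifo G)(q := ws)\<rparr>, val)"

definition init_config :: "('d, 'x, 'q, 'b, 's) qdas \<Rightarrow> ('d, 'x, 'q, 'b, 's) config" where
  "init_config A =
     (\<lparr>tasks = {0}, fifo = (\<lambda>_. []), block = (\<lambda>_. main A), queue = (\<lambda>_. None),
       state = (\<lambda>_. sinit A (main A)), waits = {}\<rparr>,
      \<lambda>_. dinit A)"

definition reachable ::
  "('d, 'x, 'q, 'b, 's) qdas \<Rightarrow> ('d, 'x, 'q, 'b, 's) config \<Rightarrow> bool" where
  "reachable A c \<longleftrightarrow> (step A)\<^sup>*\<^sup>* (init_config A) c"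

definition Parikh :: "('q, 'b, 's) ctg \<Rightarrow> 's \<Rightarrow> nat" where
  "Parikh G s = card {v \<in> verts G. state G v = s}"

definition parikh_coverable :: "('d, 'x, 'q, 'b, 's) qdas \<Rightarrow> ('s \<Rightarrow> nat) \<Rightarrow> bool" where
  "parikh_coverable A f \<longleftrightarrow>
     (\<exists>G val. reachable A (G, val) \<and> (\<forall>s\<in>all_states A. f s \<le> Parikh G s))"

section \<open>Partial recursive functions and decidability\<close>

datatype recf =
    Zero
  | Succ
  | Proj nat
  | Comp recf "recf list"
  | PrimRec recf recf
  | Mu recf

text \<open>\<open>rec_eval r xs y\<close>: the partial recursive function \<open>r\<close> is defined at \<open>xs\<close> with value \<open>y\<close>.\<close>

inductive rec_eval :: "recf \<Rightarrow> nat list \<Rightarrow> nat \<Rightarrow> bool" where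
  "rec_eval Zero xs 0"
| "rec_eval Succ [x] (Suc x)"
| "i < length xs \<Longrightarrow> rec_eval (Proj i) xs (xs ! i)"
| "length ys = length gs \<Longrightarrow> \<forall>i<length gs. rec_eval (gs ! i) xs (ys ! i) \<Longrightarrow> rec_eval h ys z \<Longrightarrow>
     rec_eval (Comp h gs) xs z"
| "rec_eval g xs y \<Longrightarrow> rec_eval (PrimRec g h) (0 # xs) y"
| "rec_eval (PrimRec g h) (n # xs) y \<Longrightarrow> rec_eval h (n # y # xs) z \<Longrightarrow>
     rec_eval (PrimRec g h) (Suc n # xs) z"
| "rec_eval g (n # xs) 0 \<Longrightarrow> \<forall>m<n. \<exists>y. rec_eval g (m # xs) (Suc y) \<Longrightarrow>
     rec_eval (Mu g) xs n"

text \<open>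
  The problem ``given an instance \<open>i \<in> I\<close>, does \<open>P i\<close> hold?'' is decidable under an encoding
  of the instances if some partial recursive function halts on the code of every instance with
  the right answer. Nothing is required of it on numbers that do not encode an instance.
\<close>

definition decidable :: "('i \<Rightarrow> nat) \<Rightarrow> 'i set \<Rightarrow> ('i \<Rightarrow> bool) \<Rightarrow> bool" where
  "decidable enc I P \<longleftrightarrow>
     (\<exists>r. \<forall>i\<in>I. rec_eval r [enc i] (if P i then 1 else 0))"

section \<open>Encoding of problem instances\<close>

text \<open>
  Up to renaming, the finitely many identifiers of a QDAS are natural numbers. Finite sets of
  numbers are encoded by \<^const>\<open>set_encode\<close>, and a function on a finite set by its graph.
\<close>

fun atom_code :: "(nat, nat) atom \<Rightarrow> nat" where
  "atom_code (Eq x d) = list_encode [0, x, d]"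
| "atom_code (Neq x d) = list_encode [1, x, d]"

fun action_code :: "(nat, nat, nat, nat) action \<Rightarrow> nat" where
  "action_code (DispatchA q \<gamma>) = list_encode [0, q, \<gamma>]"
| "action_code (DispatchS q \<gamma>) = list_encode [1, q, \<gamma>]"
| "action_code (Guard as) = list_encode (2 # map atom_code as)"
| "action_code (Assign x d) = list_encode [3, x, d]"

definition qdas_code :: "(nat, nat, nat, nat, nat) qdas \<Rightarrow> nat" where
  "qdas_code A = list_encode
     [set_encode (Dom A), dinit A, set_encode (Vars A),
      set_encode (CQID A), set_encode (SQID A),
      set_encode (Blocks A), main A,
      set_encode {list_encode [\<gamma>, s] | \<gamma> s. \<gamma> \<in> Blocks A \<and> s \<in> States A \<gamma>},
      set_encode {list_encode [\<gamma>, sinit A \<gamma>, sfinal A \<gamma>] | \<gamma>. \<gamma> \<in> Blocks A},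
      set_encode {list_encode [\<gamma>, s, action_code a, s'] | \<gamma> s a s'.
        \<gamma> \<in> Blocks A \<and> (s, a, s') \<in> Delta A \<gamma>}]"

definition instance_code :: "(nat, nat, nat, nat, nat) qdas \<times> (nat \<Rightarrow> nat) \<Rightarrow> nat" where
  "instance_code = (\<lambda>(A, f).
     list_encode [qdas_code A, set_encode {list_encode [s, f s] | s. s \<in> all_states A}])"

text \<open>
  The encoding loses nothing: instances with the same code agree except for the values of
  functions outside their domains.
\<close>

lemma atom_code_inj: "atom_code a = atom_code b \<Longrightarrow> a = b"
  by (cases a; cases b) (auto simp: list_encode_eq simp del: list_encode.simps)

lemma action_code_inj: "action_code a = action_code b \<Longrightarrow> a = b"
proof -
  have "inj atom_code" by (simp add: atom_code_inj injI)
  then show "action_code a = action_code b \<Longrightarrow> a = b"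
    by (cases a; cases b) (auto simp: list_encode_eq simp del: list_encode.simps)
qed

lemma instance_code_inj:
  assumes wf: "is_qdas A" "is_qdas B"
    and eq: "instance_code (A, f) = instance_code (B, g)"
  shows "Dom A = Dom B" "dinit A = dinit B" "Vars A = Vars B" "CQID A = CQID B"
    "SQID A = SQID B" "Blocks A = Blocks B" "main A = main B"
    "\<And>\<gamma>. \<gamma> \<in> Blocks A \<Longrightarrow> States A \<gamma> = States B \<gamma>"
    "\<And>\<gamma>. \<gamma> \<in> Blocks A \<Longrightarrow> sinit A \<gamma> = sinit B \<gamma>"
    "\<And>\<gamma>. \<gamma> \<in> Blocks A \<Longrightarrow> sfinal A \<gamma> = sfinal B \<gamma>"
    "\<And>\<gamma>. \<gamma> \<in> Blocks A \<Longrightarrow> Delta A \<gamma> = Delta B \<gamma>"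
    "\<And>s. s \<in> all_states A \<Longrightarrow> f s = g s"
proof -
  let ?S = "\<lambda>A. {list_encode [\<gamma>, s] | \<gamma> s. \<gamma> \<in> Blocks A \<and> s \<in> States A \<gamma>}"
  let ?I = "\<lambda>A. {list_encode [\<gamma>, sinit A \<gamma>, sfinal A \<gamma>] | \<gamma>. \<gamma> \<in> Blocks A}"
  let ?D = "\<lambda>A. {list_encode [\<gamma>, s, action_code a, s'] | \<gamma> s a s'.
        \<gamma> \<in> Blocks A \<and> (s, a, s') \<in> Delta A \<gamma>}"
  let ?F = "\<lambda>A f. {list_encode [s, f s] | s. s \<in> all_states A}"
  have fin: "finite (?S C)" "finite (?I C)" "finite (?D C)" "finite (?F C h)"
    if "is_qdas C" for C :: "(nat, nat, nat, nat, nat) qdas" and h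
  proof -
    have "?S C = (\<lambda>(\<gamma>, s). list_encode [\<gamma>, s]) ` (SIGMA \<gamma>:Blocks C. States C \<gamma>)"
      by (auto simp: image_iff simp del: list_encode.simps)
    then show "finite (?S C)" using that by (auto simp: is_qdas_def)
    show "finite (?I C)" using that by (auto simp: is_qdas_def)
    have "?D C = (\<lambda>(\<gamma>, s, a, s'). list_encode [\<gamma>, s, action_code a, s'])
      ` (SIGMA \<gamma>:Blocks C. Delta C \<gamma>)"
      by (force simp: image_iff simp del: list_encode.simps)
    then show "finite (?D C)" using that by (auto simp: is_qdas_def)
    show "finite (?F C h)" using that by (auto simp: is_qdas_def all_states_def)
  qed
  have wf': "finite (Dom C)" "finite (Vars C)" "finite (CQID C)" "finite (SQID C)"
    "finite (Blocks C)" if "is_qdas C" for C :: "(nat, nat, nat, nat, nat) qdas"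
    using that by (auto simp: is_qdas_def)
  note E = eq[unfolded instance_code_def qdas_code_def prod.case list_encode_eq list.inject]
  have E1: "set_encode (Dom A) = set_encode (Dom B)" "set_encode (Vars A) = set_encode (Vars B)"
    "set_encode (CQID A) = set_encode (CQID B)" "set_encode (SQID A) = set_encode (SQID B)"
    "set_encode (Blocks A) = set_encode (Blocks B)"
    and E2: "set_encode (?S A) = set_encode (?S B)" "set_encode (?I A) = set_encode (?I B)"
    "set_encode (?D A) = set_encode (?D B)" "set_encode (?F A f) = set_encode (?F B g)"
    by (insert E, (elim conjE, assumption)+)
  show "dinit A = dinit B" "main A = main B"
    by (insert E, (elim conjE, assumption)+)
  show "Dom A = Dom B" "Vars A = Vars B" "CQID A = CQID B" "SQID A = SQID B"
    and B: "Blocks A = Blocks B"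
    using E1 wf'[OF wf(1)] wf'[OF wf(2)] by (simp_all only: set_encode_eq)
  have S: "?S A = ?S B" and I: "?I A = ?I B" and D: "?D A = ?D B" and F: "?F A f = ?F B g"
    using E2 fin[OF wf(1)] fin[OF wf(2)] by (simp_all only: set_encode_eq)
  show "f s = g s" if "s \<in> all_states A" for s
  proof -
    have "list_encode [s, f s] \<in> ?F B g" using F that by blast
    then show ?thesis by (auto simp: list_encode_eq simp del: list_encode.simps)
  qed
  fix \<gamma> assume \<gamma>: "\<gamma> \<in> Blocks A"
  have "s \<in> States A \<gamma> \<longleftrightarrow> list_encode [\<gamma>, s] \<in> ?S A"
    "s \<in> States B \<gamma> \<longleftrightarrow> list_encode [\<gamma>, s] \<in> ?S B" for s
    using \<gamma> B by (auto simp: list_encode_eq simp del: list_encode.simps)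
  then show "States A \<gamma> = States B \<gamma>" using S by blast
  have "list_encode [\<gamma>, sinit A \<gamma>, sfinal A \<gamma>] \<in> ?I B" using I \<gamma> by blast
  then show "sinit A \<gamma> = sinit B \<gamma>" "sfinal A \<gamma> = sfinal B \<gamma>"
    by (auto simp: list_encode_eq simp del: list_encode.simps)
  have DAB: "(s, a, s') \<in> Delta A \<gamma> \<longleftrightarrow> list_encode [\<gamma>, s, action_code a, s'] \<in> ?D A"
    "(s, a, s') \<in> Delta B \<gamma> \<longleftrightarrow> list_encode [\<gamma>, s, action_code a, s'] \<in> ?D B" for s a s'
    using \<gamma> B by (auto simp: list_encode_eq dest!: action_code_inj simp del: list_encode.simps)
  have "t \<in> Delta A \<gamma> \<longleftrightarrow> t \<in> Delta B \<gamma>" for t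
    by (cases t) (simp only: DAB D)
  then show "Delta A \<gamma> = Delta B \<gamma>" by blast
qed

end

theory Submission
  imports Defs
begin

text \<open>
  A serial queue holds a word over the blocks, and since its tasks run one at a time, the main
  block can read the word from the front while it appends to its end. So an asynchronous QDAS with
  one serial queue simulates a queue machine, which in turn evaluates any partial recursive
  function: the registers of a loop program are kept in the queue as multiplicities of letters.
  Suppose \<open>r\<close> decides coverability, and consider a program that applies \<open>r\<close> to the code of an
  instance and enters the target state if and only if \<open>r\<close> answers \<open>0\<close>. Its instance loads a number \<open>n\<close>
  into the input register by a chain of \<open>n\<close> dispatches. Choosing for \<open>n\<close> the code of the transitions of
  the program, the code of the whole instance is a recursive function of \<open>n\<close>, so that the program
  can ask \<open>r\<close> about its own instance, and \<open>r\<close> answers wrongly.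
\<close>

section \<open>Loop programs for partial recursive functions\<close>

text \<open>Coverability asks for one run among many. To refute \<open>r\<close>, some run must
  reach the target when \<open>r\<close> answers 0, and no run may reach it when \<open>r\<close>
  answers 1. The second demand is why the queue machine is deterministic and ends in a dead state.
  The main block cannot wait for a call that it has dispatched asynchronously. Waiting is built from
  one shared variable: the value 0 means that a letter is requested, and each letter block is held
  by a guard until it sees 0. As a serial queue runs one task at a time, only the front letter can
  answer. The self-reference needs neither a universal function nor the recursion theorem. The
  program is fixed before \<open>n\<close> exists; \<open>n\<close> codes its edges only and enters
  through the loading chain. The chain, the letter blocks and all bounds are regular families
  indexed by \<open>n\<close>, so the code of the instance is an explicit expression in sums of
  powers of two.\<close>

datatype prog = Skip | Inc nat | Seq prog prog | Loop nat prog

text \<open>\<open>Loop\<close> is a while loop: its body may change the register that it tests,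
  which unbounded search relies on. Test and decrement are one operation because a queue machine
  finds a letter by taking it out of the queue.\<close>

inductive exec :: "prog \<Rightarrow> (nat \<Rightarrow> nat) \<Rightarrow> (nat \<Rightarrow> nat) \<Rightarrow> bool" where
  skip: "exec Skip \<sigma> \<sigma>"
| inc: "exec (Inc i) \<sigma> (\<sigma>(i := Suc (\<sigma> i)))"
| seq: "exec p \<sigma> \<sigma>' \<Longrightarrow> exec q \<sigma>' \<sigma>'' \<Longrightarrow> exec (Seq p q) \<sigma> \<sigma>''"
| loop_done: "\<sigma> i = 0 \<Longrightarrow> exec (Loop i p) \<sigma> \<sigma>"
| loop_step: "\<sigma> i = Suc m \<Longrightarrow> exec p (\<sigma>(i := m)) \<sigma>' \<Longrightarrow> exec (Loop i p) \<sigma>' \<sigma>'' \<Longrightarrow>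
    exec (Loop i p) \<sigma> \<sigma>''"

definition clear :: "nat \<Rightarrow> prog" where
  "clear i = Loop i Skip"

lemma exec_clear: "exec (clear i) \<sigma> (\<sigma>(i := 0))"
proof (induction "\<sigma> i" arbitrary: \<sigma>)
  case 0
  then have "\<sigma>(i := 0) = \<sigma>" by auto
  with 0 show ?case unfolding clear_def by (metis loop_done)
next
  case (Suc m)
  have "exec (clear i) (\<sigma>(i := m)) (\<sigma>(i := 0))"
    using Suc.hyps(1)[of "\<sigma>(i := m)"] by simp
  then show ?case
    using Suc.hyps(2) unfolding clear_def by (metis loop_step skip)
qed

text \<open>A loop destroys the register that it tests, so the value is spread over \<open>b\<close>
  and \<open>t\<close> and then restored from \<open>t\<close>.\<close>

definition copy :: "nat \<Rightarrow> nat \<Rightarrow> nat \<Rightarrow> prog" where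
  "copy a b t = Seq (clear b) (Seq (clear t)
     (Seq (Loop a (Seq (Inc b) (Inc t))) (Loop t (Inc a))))"

lemma exec_copy:
  assumes "a \<noteq> b" "a \<noteq> t" "b \<noteq> t"
  shows "exec (copy a b t) \<sigma> (\<sigma>(b := \<sigma> a, t := 0))"
proof -
  have spread: "exec (Loop a (Seq (Inc b) (Inc t))) \<sigma> (\<sigma>(a := 0, b := \<sigma> b + m, t := \<sigma> t + m))"
    if "\<sigma> a = m" for m \<sigma>
    using that
  proof (induction m arbitrary: \<sigma>)
    case 0
    then have "\<sigma>(a := 0, b := \<sigma> b + 0, t := \<sigma> t + 0) = \<sigma>" by auto
    with 0 show ?case by (metis loop_done)
  next
    case (Suc m)
    let ?\<sigma>' = "\<sigma>(a := m, b := Suc (\<sigma> b), t := Suc (\<sigma> t))"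
    have "exec (Seq (Inc b) (Inc t)) (\<sigma>(a := m)) ?\<sigma>'"
      using exec.seq[OF exec.inc[of b "\<sigma>(a := m)"] exec.inc[of t]] assms by simp
    moreover have "exec (Loop a (Seq (Inc b) (Inc t))) ?\<sigma>'
      (\<sigma>(a := 0, b := \<sigma> b + Suc m, t := \<sigma> t + Suc m))"
    proof -
      have eq: "?\<sigma>'(a := 0, b := ?\<sigma>' b + m, t := ?\<sigma>' t + m) =
          \<sigma>(a := 0, b := \<sigma> b + Suc m, t := \<sigma> t + Suc m)"
        using assms by auto
      have "?\<sigma>' a = m" using assms by simp
      from Suc.IH[of ?\<sigma>', OF this] show ?thesis unfolding eq .
    qed
    ultimately show ?case using Suc.prems by (blast intro: exec.loop_step)
  qed
  have gather: "exec (Loop t (Inc a)) \<sigma> (\<sigma>(t := 0, a := \<sigma> a + m))" if "\<sigma> t = m" for m \<sigma>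
    using that
  proof (induction m arbitrary: \<sigma>)
    case 0
    then have "\<sigma>(t := 0, a := \<sigma> a + 0) = \<sigma>" by auto
    with 0 show ?case by (metis loop_done)
  next
    case (Suc m)
    let ?\<sigma>' = "\<sigma>(t := m, a := Suc (\<sigma> a))"
    have "exec (Inc a) (\<sigma>(t := m)) ?\<sigma>'"
      using exec.inc[of a "\<sigma>(t := m)"] assms by simp
    moreover have "exec (Loop t (Inc a)) ?\<sigma>' (\<sigma>(t := 0, a := \<sigma> a + Suc m))"
    proof -
      have eq: "?\<sigma>'(t := 0, a := ?\<sigma>' a + m) = \<sigma>(t := 0, a := \<sigma> a + Suc m)"
        using assms by auto
      have "?\<sigma>' t = m" using assms by simp
      from Suc.IH[of ?\<sigma>', OF this] show ?thesis unfolding eq .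
    qed
    ultimately show ?case using Suc.prems by (blast intro: exec.loop_step)
  qed
  let ?s2 = "\<sigma>(b := 0, t := 0)"
  let ?s3 = "?s2(a := 0, b := \<sigma> a, t := \<sigma> a)"
  have "exec (Loop a (Seq (Inc b) (Inc t))) ?s2 ?s3"
    using spread[of ?s2 "\<sigma> a"] assms by simp
  moreover have "exec (Loop t (Inc a)) ?s3 (?s3(t := 0, a := \<sigma> a))"
    using gather[of ?s3 "\<sigma> a"] assms by simp
  moreover have "?s3(t := 0, a := \<sigma> a) = \<sigma>(b := \<sigma> a, t := 0)"
    using assms by auto
  ultimately show ?thesis
    unfolding copy_def by (metis exec_clear exec.seq)
qed

text \<open>
  \<open>compile r as d n\<close> evaluates \<open>r\<close> on the registers \<open>as\<close> into the register \<open>d\<close>; registers from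
  \<open>n\<close> on are scratch space whose initial contents do not matter.
\<close>

fun compile :: "recf \<Rightarrow> nat list \<Rightarrow> nat \<Rightarrow> nat \<Rightarrow> prog"
  and compile_list :: "recf list \<Rightarrow> nat list \<Rightarrow> nat \<Rightarrow> nat \<Rightarrow> prog" where
  "compile Zero as d n = clear d"
| "compile Succ as d n = Seq (copy (hd as) d n) (Inc d)"
| "compile (Proj i) as d n = copy (as ! i) d n"
| "compile (Comp h gs) as d n =
     Seq (compile_list gs as n (n + length gs))
         (compile h [n..<n + length gs] d (n + length gs))"
| "compile (PrimRec g h) as d n =
     Seq (copy (hd as) (n + 2) n) (Seq (clear n) (Seq (compile g (tl as) (n + 1) (n + 4))
       (Seq (Loop (n + 2)
               (Seq (compile h (n # (n + 1) # tl as) (n + 3) (n + 4))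
               (Seq (copy (n + 3) (n + 1) (n + 4)) (Inc n))))
            (copy (n + 1) d n))))"
| "compile (Mu g) as d n =
     Seq (clear n) (Seq (compile g (n # as) (n + 1) (n + 2))
       (Seq (Loop (n + 1) (Seq (Inc n) (compile g (n # as) (n + 1) (n + 2))))
            (copy n d (n + 1))))"
| "compile_list [] as d n = Skip"
| "compile_list (g # gs) as d n = Seq (compile g as d n) (compile_list gs as (Suc d) n)"

text \<open>Nothing is assumed of the old contents of \<open>d\<close> and of the registers from
  \<open>n\<close> on: loop bodies are run again on used scratch space. All other registers below
  \<open>n\<close> survive, which makes fragments composable.\<close>

definition computes :: "(nat list \<Rightarrow> nat \<Rightarrow> nat \<Rightarrow> prog) \<Rightarrow> nat list \<Rightarrow> nat \<Rightarrow> bool" where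
  "computes c xs y \<longleftrightarrow> (\<forall>as d n \<sigma>. map \<sigma> as = xs \<longrightarrow> set as \<subseteq> {..<n} \<longrightarrow> d < n \<longrightarrow> d \<notin> set as \<longrightarrow>
     (\<exists>\<sigma>'. exec (c as d n) \<sigma> \<sigma>' \<and> \<sigma>' d = y \<and> (\<forall>i<n. i \<noteq> d \<longrightarrow> \<sigma>' i = \<sigma> i)))"

lemma computesI:
  assumes "\<And>as d n \<sigma>. map \<sigma> as = xs \<Longrightarrow> set as \<subseteq> {..<n} \<Longrightarrow> d < n \<Longrightarrow> d \<notin> set as \<Longrightarrow>
    exec (c as d n) \<sigma> (f as d n \<sigma>) \<and> f as d n \<sigma> d = y \<and> (\<forall>i<n. i \<noteq> d \<longrightarrow> f as d n \<sigma> i = \<sigma> i)"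
  shows "computes c xs y"
  using assms unfolding computes_def by blast

lemma computesE:
  assumes "computes c xs y" "map \<sigma> as = xs" "set as \<subseteq> {..<n}" "d < n" "d \<notin> set as"
  obtains \<sigma>' where "exec (c as d n) \<sigma> \<sigma>'" "\<sigma>' d = y" "\<And>i. i < n \<Longrightarrow> i \<noteq> d \<Longrightarrow> \<sigma>' i = \<sigma> i"
  using assms unfolding computes_def by blast

lemma computes_list:
  assumes "length ys = length gs" "\<forall>i<length gs. computes (compile (gs ! i)) xs (ys ! i)"
    and "map \<sigma> as = xs" "set as \<subseteq> {..<d}" "d + length gs \<le> n"
  shows "\<exists>\<sigma>'. exec (compile_list gs as d n) \<sigma> \<sigma>' \<and> map \<sigma>' [d..<d + length gs] = ys \<and>
    (\<forall>i<d. \<sigma>' i = \<sigma> i)"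
  using assms
proof (induction gs arbitrary: ys d \<sigma>)
  case Nil
  then show ?case by (auto intro: exec.skip)
next
  case (Cons g gs)
  then obtain y ys' where ys: "ys = y # ys'" by (cases ys) auto
  have "computes (compile g) xs y" using Cons.prems(2) ys by force
  then obtain \<sigma>1 where 1: "exec (compile g as d n) \<sigma> \<sigma>1" "\<sigma>1 d = y"
      "\<And>i. i < n \<Longrightarrow> i \<noteq> d \<Longrightarrow> \<sigma>1 i = \<sigma> i"
    by (rule computesE[of _ _ _ \<sigma> as n d]) (use Cons.prems in auto)
  have "\<exists>\<sigma>'. exec (compile_list gs as (Suc d) n) \<sigma>1 \<sigma>' \<and>
      map \<sigma>' [Suc d..<Suc d + length gs] = ys' \<and> (\<forall>i<Suc d. \<sigma>' i = \<sigma>1 i)"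
  proof (rule Cons.IH)
    show "map \<sigma>1 as = xs" using Cons.prems(3-5) 1(3) by fastforce
    show "\<forall>i<length gs. computes (compile (gs ! i)) xs (ys' ! i)"
      using Cons.prems(2) ys by force
  qed (use Cons.prems ys in auto)
  then obtain \<sigma>2 where 2: "exec (compile_list gs as (Suc d) n) \<sigma>1 \<sigma>2"
      "map \<sigma>2 [Suc d..<Suc d + length gs] = ys'" "\<forall>i<Suc d. \<sigma>2 i = \<sigma>1 i" by blast
  have "map \<sigma>2 [d..<d + length (g # gs)] = ys"
    using 2 1(2) ys by (simp add: upt_conv_Cons del: upt_Suc)
  moreover have "\<forall>i<d. \<sigma>2 i = \<sigma> i" using 1(3) 2(3) Cons.prems(5) by auto
  ultimately show ?case using 1(1) 2(1) by (auto intro: exec.seq)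
qed

lemma computes_Comp:
  assumes "length ys = length gs" "\<forall>i<length gs. computes (compile (gs ! i)) xs (ys ! i)"
    and "computes (compile h) ys z"
  shows "computes (compile (Comp h gs)) xs z"
  unfolding computes_def
proof (intro allI impI)
  fix as :: "nat list" and d n :: nat and \<sigma> :: "nat \<Rightarrow> nat"
  assume as: "map \<sigma> as = xs" "set as \<subseteq> {..<n}" "d < n" "d \<notin> set as"
  obtain \<sigma>1 where 1: "exec (compile_list gs as n (n + length gs)) \<sigma> \<sigma>1"
    "map \<sigma>1 [n..<n + length gs] = ys" "\<forall>i<n. \<sigma>1 i = \<sigma> i"
    using computes_list[OF assms(1,2) as(1,2)] by blast
  obtain \<sigma>2 where 2: "exec (compile h [n..<n + length gs] d (n + length gs)) \<sigma>1 \<sigma>2" "\<sigma>2 d = z"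
      "\<And>i. i < n + length gs \<Longrightarrow> i \<noteq> d \<Longrightarrow> \<sigma>2 i = \<sigma>1 i"
    by (rule computesE[OF assms(3) 1(2), of "n + length gs" d]) (use as in auto)
  have "exec (compile (Comp h gs) as d n) \<sigma> \<sigma>2" using 1 2 by (auto intro: exec.seq)
  then show "\<exists>\<sigma>'. exec (compile (Comp h gs) as d n) \<sigma> \<sigma>' \<and> \<sigma>' d = z \<and>
      (\<forall>i<n. i \<noteq> d \<longrightarrow> \<sigma>' i = \<sigma> i)"
    using 1(3) 2 by (intro exI[of _ \<sigma>2]) auto
qed

text \<open>Register \<open>n\<close> holds the round, \<open>n + 1\<close> the current value,
  \<open>n + 2\<close> the number of rounds left and \<open>n + 3\<close> the next value. The
  function \<open>y\<close> tabulates the values of the recursion.\<close>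

lemma computes_PrimRec:
  assumes g: "computes (compile g) xs (y 0)"
    and h: "\<And>i. i < m \<Longrightarrow> computes (compile h) (i # y i # xs) (y (Suc i))"
  shows "computes (compile (PrimRec g h)) (m # xs) (y m)"
  unfolding computes_def
proof (intro allI impI)
  fix as :: "nat list" and d n :: nat and \<sigma> :: "nat \<Rightarrow> nat"
  assume as: "map \<sigma> as = m # xs" "set as \<subseteq> {..<n}" "d < n" "d \<notin> set as"
  then obtain a bs where ab: "as = a # bs" "\<sigma> a = m" "map \<sigma> bs = xs" by auto
  have lt: "a < n" "set bs \<subseteq> {..<n}" and bs: "\<And>i. i \<in> set bs \<Longrightarrow> i < n"
    using as ab by auto
  define body where "body = Seq (compile h (n # (n + 1) # bs) (n + 3) (n + 4))
               (Seq (copy (n + 3) (n + 1) (n + 4)) (Inc n))"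
  \<comment> \<open>The invariant is that the round and the rounds left add up to \<open>m\<close>,
    and that \<open>n + 1\<close> holds the table entry of the round.\<close>
  have loop: "\<exists>\<sigma>'. exec (Loop (n + 2) body) \<sigma>1 \<sigma>' \<and> \<sigma>' (n + 1) = y m \<and> (\<forall>i<n. \<sigma>' i = \<sigma> i)"
    if "\<sigma>1 (n + 2) = k" "\<sigma>1 n + k = m" "\<sigma>1 (n + 1) = y (\<sigma>1 n)" "\<forall>i<n. \<sigma>1 i = \<sigma> i" for \<sigma>1 k
    using that
  proof (induction k arbitrary: \<sigma>1)
    case 0
    then show ?case by (auto intro: exec.loop_done)
  next
    case (Suc k)
    let ?s = "\<sigma>1(n + 2 := k)"
    have hy: "computes (compile h) (\<sigma>1 n # y (\<sigma>1 n) # xs) (y (Suc (\<sigma>1 n)))"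
      using Suc.prems(2) by (intro h) auto
    have "map ?s bs = xs" using ab(3) lt(2) Suc.prems(4) by fastforce
    then obtain \<sigma>2 where 2: "exec (compile h (n # (n + 1) # bs) (n + 3) (n + 4)) ?s \<sigma>2"
        "\<sigma>2 (n + 3) = y (Suc (\<sigma>1 n))" "\<And>i. i < n + 4 \<Longrightarrow> i \<noteq> n + 3 \<Longrightarrow> \<sigma>2 i = ?s i"
      by (rule_tac computesE[OF hy, of ?s "n # (n + 1) # bs" "n + 4" "n + 3"])
        (use lt(2) Suc.prems(3) in auto)
    let ?s3 = "\<sigma>2(n + 1 := \<sigma>2 (n + 3), n + 4 := 0)"
    let ?s4 = "?s3(n := Suc (?s3 n))"
    have "exec (copy (n + 3) (n + 1) (n + 4)) \<sigma>2 ?s3" by (rule exec_copy) auto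
    then have e: "exec body ?s ?s4"
      unfolding body_def using 2(1) exec.inc[of n ?s3] by (blast intro: exec.seq)
    have "\<exists>\<sigma>'. exec (Loop (n + 2) body) ?s4 \<sigma>' \<and> \<sigma>' (n + 1) = y m \<and> (\<forall>i<n. \<sigma>' i = \<sigma> i)"
      by (rule Suc.IH) (use 2 Suc.prems in auto)
    then show ?case using e Suc.prems(1) by (blast intro: exec.loop_step)
  qed
  let ?s1 = "\<sigma>(n + 2 := m, n := 0)"
  have 1: "exec (copy a (n + 2) n) \<sigma> ?s1" "exec (clear n) ?s1 ?s1"
    using exec_copy[of a "n + 2" n \<sigma>] exec_clear[of n ?s1] lt ab(2) by auto
  have "map ?s1 bs = xs" using ab(3) bs by force
  then obtain \<sigma>2 where 2: "exec (compile g bs (n + 1) (n + 4)) ?s1 \<sigma>2"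
      "\<sigma>2 (n + 1) = y 0" "\<And>i. i < n + 4 \<Longrightarrow> i \<noteq> n + 1 \<Longrightarrow> \<sigma>2 i = ?s1 i"
    by (rule_tac computesE[OF g, of ?s1 bs "n + 4" "n + 1"]) (use lt(2) in auto)
  obtain \<sigma>3 where 3: "exec (Loop (n + 2) body) \<sigma>2 \<sigma>3" "\<sigma>3 (n + 1) = y m" "\<forall>i<n. \<sigma>3 i = \<sigma> i"
    using loop[of \<sigma>2 m] 2 by auto
  let ?s4 = "\<sigma>3(d := \<sigma>3 (n + 1), n := 0)"
  have "exec (copy (n + 1) d n) \<sigma>3 ?s4" by (rule exec_copy) (use as in auto)
  then have "exec (compile (PrimRec g h) as d n) \<sigma> ?s4"
    using 1 2(1) 3(1) unfolding body_def by (simp add: ab) (blast intro: exec.seq)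
  then show "\<exists>\<sigma>'. exec (compile (PrimRec g h) as d n) \<sigma> \<sigma>' \<and> \<sigma>' d = y m \<and>
      (\<forall>i<n. i \<noteq> d \<longrightarrow> \<sigma>' i = \<sigma> i)"
    using 3 as by (intro exI[of _ ?s4]) auto
qed

text \<open>Register \<open>n\<close> holds the candidate and \<open>n + 1\<close> the value of
  \<open>g\<close> at it. The decrement of \<open>n + 1\<close> at each test is harmless, since the
  body recomputes that register. The loop is followed by induction on the number of candidates left
  before \<open>m\<close>.\<close>

lemma computes_Mu:
  assumes zero: "computes (compile g) (m # xs) 0"
    and pos: "\<And>i. i < m \<Longrightarrow> \<exists>y. computes (compile g) (i # xs) (Suc y)"
  shows "computes (compile (Mu g)) xs m"
  unfolding computes_def
proof (intro allI impI)
  fix as :: "nat list" and d n :: nat and \<sigma> :: "nat \<Rightarrow> nat"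
  assume as: "map \<sigma> as = xs" "set as \<subseteq> {..<n}" "d < n" "d \<notin> set as"
  let ?G = "compile g (n # as) (n + 1) (n + 2)"
  have G: "\<exists>\<sigma>'. exec ?G \<sigma>1 \<sigma>' \<and> \<sigma>' n = \<sigma>1 n \<and> (\<forall>i<n. \<sigma>' i = \<sigma> i) \<and>
      (if \<sigma>1 n = m then \<sigma>' (n + 1) = 0 else \<sigma>' (n + 1) \<noteq> 0)"
    if s: "\<sigma>1 n \<le> m" "\<forall>i<n. \<sigma>1 i = \<sigma> i" for \<sigma>1
  proof -
    obtain y where y: "computes (compile g) (\<sigma>1 n # xs) y" "if \<sigma>1 n = m then y = 0 else y \<noteq> 0"
      using zero pos[of "\<sigma>1 n"] s(1) by (cases "\<sigma>1 n = m") auto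
    have "map \<sigma>1 (n # as) = \<sigma>1 n # xs" using as(1,2) s(2) by force
    then obtain \<sigma>2 where "exec ?G \<sigma>1 \<sigma>2"
        "\<sigma>2 (n + 1) = y" "\<And>i. i < n + 2 \<Longrightarrow> i \<noteq> n + 1 \<Longrightarrow> \<sigma>2 i = \<sigma>1 i"
      by (rule_tac computesE[OF y(1), of \<sigma>1 "n # as" "n + 2" "n + 1"]) (use as in auto)
    then show ?thesis using s y(2) by (intro exI[of _ \<sigma>2]) auto
  qed
  have loop: "\<exists>\<sigma>'. exec (Loop (n + 1) (Seq (Inc n) ?G)) \<sigma>1 \<sigma>' \<and> \<sigma>' n = m \<and> (\<forall>i<n. \<sigma>' i = \<sigma> i)"
    if "\<sigma>1 n + k = m" "\<forall>i<n. \<sigma>1 i = \<sigma> i"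
       "if \<sigma>1 n = m then \<sigma>1 (n + 1) = 0 else \<sigma>1 (n + 1) \<noteq> 0" for \<sigma>1 k
    using that
  proof (induction k arbitrary: \<sigma>1)
    case 0
    then show ?case by (auto intro: exec.loop_done)
  next
    case (Suc k)
    obtain v where v: "\<sigma>1 (n + 1) = Suc v" using Suc.prems by (cases "\<sigma>1 (n + 1)") auto
    let ?s = "\<sigma>1(n + 1 := v)" let ?s' = "?s(n := Suc (?s n))"
    obtain \<sigma>2 where 2: "exec ?G ?s' \<sigma>2" "\<sigma>2 n = ?s' n" "\<forall>i<n. \<sigma>2 i = \<sigma> i"
        "if ?s' n = m then \<sigma>2 (n + 1) = 0 else \<sigma>2 (n + 1) \<noteq> 0"
      using G[of ?s'] Suc.prems by auto
    have "\<exists>\<sigma>'. exec (Loop (n + 1) (Seq (Inc n) ?G)) \<sigma>2 \<sigma>' \<and> \<sigma>' n = m \<and> (\<forall>i<n. \<sigma>' i = \<sigma> i)"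
      by (rule Suc.IH) (use 2 Suc.prems in auto)
    moreover have "exec (Seq (Inc n) ?G) ?s \<sigma>2"
      using 2(1) exec.inc[of n ?s] by (blast intro: exec.seq)
    ultimately show ?case using v by (blast intro: exec.loop_step)
  qed
  obtain \<sigma>1 where 1: "exec ?G (\<sigma>(n := 0)) \<sigma>1" "\<sigma>1 n = 0" "\<forall>i<n. \<sigma>1 i = \<sigma> i"
      "if m = 0 then \<sigma>1 (n + 1) = 0 else \<sigma>1 (n + 1) \<noteq> 0"
    using G[of "\<sigma>(n := 0)"] by auto
  obtain \<sigma>2 where 2: "exec (Loop (n + 1) (Seq (Inc n) ?G)) \<sigma>1 \<sigma>2" "\<sigma>2 n = m" "\<forall>i<n. \<sigma>2 i = \<sigma> i"
    using loop[of \<sigma>1 m] 1 by auto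
  let ?s = "\<sigma>2(d := \<sigma>2 n, n + 1 := 0)"
  have "exec (copy n d (n + 1)) \<sigma>2 ?s" by (rule exec_copy) (use as in auto)
  then have "exec (compile (Mu g) as d n) \<sigma> ?s"
    using 1(1) 2(1) exec_clear[of n \<sigma>] by (auto intro!: exec.seq)
  then show "\<exists>\<sigma>'. exec (compile (Mu g) as d n) \<sigma> \<sigma>' \<and> \<sigma>' d = m \<and>
      (\<forall>i<n. i \<noteq> d \<longrightarrow> \<sigma>' i = \<sigma> i)"
    using 2 as by (intro exI[of _ ?s]) auto
qed

lemma computes_compile: "rec_eval r xs y \<Longrightarrow> computes (compile r) xs y"
proof -
  \<comment> \<open>In the successor case the induction hypothesis for the recursive premise speaks
    of the compiled \<open>PrimRec\<close> as a whole, while \<open>computes_PrimRec\<close> needs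
    the values of every round. The predicate \<open>tab\<close> carries these values through the
    induction.\<close>
  define tab where "tab g h xs y \<longleftrightarrow> (\<exists>m xs' t. xs = m # xs' \<and> y = t m \<and>
      computes (compile g) xs' (t 0) \<and>
      (\<forall>i<m. computes (compile h) (i # t i # xs') (t (Suc i))))" for g h xs y
  have tab: "computes (compile (PrimRec g h)) xs y" if "tab g h xs y" for g h xs y
    using that computes_PrimRec unfolding tab_def by blast
  assume "rec_eval r xs y"
  then have "computes (compile r) xs y \<and> (\<forall>g h. r = PrimRec g h \<longrightarrow> tab g h xs y)"
  proof (induction rule: rec_eval.induct)
    case (1 xs)
    have "computes (compile Zero) xs 0"
      by (rule computesI[where f = "\<lambda>as d n \<sigma>. \<sigma>(d := 0)"]) (simp add: exec_clear)
    then show ?case by (simp del: compile.simps)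
  next
    case (2 x)
    have "exec (compile Succ as d n) \<sigma> (\<sigma>(d := x, n := 0, d := Suc x))"
      if as: "map \<sigma> as = [x]" "set as \<subseteq> {..<n}" "d < n" "d \<notin> set as" for as d n \<sigma>
    proof -
      obtain a where a: "as = [a]" "\<sigma> a = x" using as(1) by (cases as) auto
      have "exec (copy a d n) \<sigma> (\<sigma>(d := \<sigma> a, n := 0))"
        by (rule exec_copy) (use that a in auto)
      then show ?thesis
        using a that exec.inc[of d "\<sigma>(d := x, n := 0)"] by (auto intro: exec.seq)
    qed
    then have "computes (compile Succ) [x] (Suc x)"
      by (intro computesI[where f = "\<lambda>as d n \<sigma>. \<sigma>(d := x, n := 0, d := Suc x)"]) simp
    then show ?case by (simp del: compile.simps)
  next
    case (3 i xs)
    have "exec (compile (Proj i) as d n) \<sigma> (\<sigma>(d := xs ! i, n := 0))"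
      if "map \<sigma> as = xs" "set as \<subseteq> {..<n}" "d < n" "d \<notin> set as" for as d n \<sigma>
    proof -
      have "as ! i \<in> set as" "\<sigma> (as ! i) = xs ! i" using 3 that(1) by auto
      then show ?thesis using exec_copy[of "as ! i" d n \<sigma>] that by auto
    qed
    then have "computes (compile (Proj i)) xs (xs ! i)"
      by (intro computesI[where f = "\<lambda>as d n \<sigma>. \<sigma>(d := xs ! i, n := 0)"]) simp
    then show ?case by (simp del: compile.simps)
  next
    case (4 ys gs xs h z)
    then show ?case using computes_Comp by blast
  next
    case (5 g xs y h)
    then have "tab g h (0 # xs) y" unfolding tab_def by (auto intro!: exI[of _ "\<lambda>_. y"])
    then show ?case using tab by blast
  next
    case (6 g h n xs y z)
    then obtain t where t: "y = t n" "computes (compile g) xs (t 0)"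
        "\<forall>i<n. computes (compile h) (i # t i # xs) (t (Suc i))"
      unfolding tab_def by blast
    have "tab g h (Suc n # xs) z" unfolding tab_def
      by (rule exI[of _ "Suc n"], rule exI[of _ xs], rule exI[of _ "t(Suc n := z)"])
        (use t 6 in \<open>auto simp: less_Suc_eq\<close>)
    then show ?case using tab by blast
  next
    case (7 g n xs)
    then show ?case using computes_Mu by blast
  qed
  then show "computes (compile r) xs y" by blast
qed

section \<open>Queue machines as asynchronous QDAS\<close>

datatype qact = Put nat | Ask | Got nat

type_synonym qmachine = "(nat \<times> qact \<times> nat) set"

text \<open>A configuration consists of the control state, the variable and the queue. The rule
  \<open>serve\<close> involves no edge: it is the move of the front letter block, which runs beside
  the control.\<close>

inductive qstep :: "qmachine \<Rightarrow> nat \<times> nat \<times> nat list \<Rightarrow> nat \<times> nat \<times> nat list \<Rightarrow> bool" for E where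
  put: "(s, Put c, t) \<in> E \<Longrightarrow> qstep E (s, x, w) (t, x, w @ [c])"
| ask: "(s, Ask, t) \<in> E \<Longrightarrow> qstep E (s, x, w) (t, 0, w)"
| got: "(s, Got c, t) \<in> E \<Longrightarrow> qstep E (s, c, w) (t, c, w)"
| serve: "qstep E (s, 0, c # w) (s, c, w)"

fun act_over :: "nat \<Rightarrow> qact \<Rightarrow> bool" where
  "act_over N (Put c) \<longleftrightarrow> 0 < c \<and> c \<le> N"
| "act_over N Ask \<longleftrightarrow> True"
| "act_over N (Got c) \<longleftrightarrow> 0 < c \<and> c \<le> N"

text \<open>Letter 0 is excluded because block 0 is main and the value 0 marks an open request.
  After \<open>Ask\<close> the control may only wait for a letter, so it cannot race with
  \<open>serve\<close>.\<close>

definition is_qmachine :: "nat \<Rightarrow> nat \<Rightarrow> qmachine \<Rightarrow> bool" where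
  "is_qmachine M N E \<longleftrightarrow> finite E \<and>
     (\<forall>(s, a, t) \<in> E. s \<le> M \<and> t \<le> M \<and> act_over N a) \<and>
     (\<forall>s t a t'. (s, Ask, t) \<in> E \<longrightarrow> (t, a, t') \<in> E \<longrightarrow> (\<exists>c. a = Got c))"

fun qact_action :: "qact \<Rightarrow> (nat, nat, nat, nat) action" where
  "qact_action (Put c) = DispatchA 0 c"
| "qact_action Ask = Assign 0 0"
| "qact_action (Got c) = Guard [Eq 0 c]"

text \<open>
  The main block is the control of the queue machine, and the calls waiting in the only serial
  queue are its queue contents. The machine asks for the next letter by resetting the variable
  to \<open>0\<close>; the block of the first letter then answers by writing its name into the variable.
\<close>

definition qdas_of :: "nat \<Rightarrow> nat \<Rightarrow> nat \<Rightarrow> qmachine \<Rightarrow> (nat, nat, nat, nat, nat) qdas" where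
  "qdas_of M N s0 E = \<lparr>
     Dom = {..N}, dinit = 1, Vars = {0}, CQID = {}, SQID = {0}, Blocks = {..N}, main = 0,
     States = (\<lambda>c. if c = 0 then {4 * i | i. i \<le> M} else {4 * c + 1, 4 * c + 2, 4 * c + 3}),
     sinit = (\<lambda>c. if c = 0 then 4 * s0 else 4 * c + 1),
     sfinal = (\<lambda>c. if c = 0 then 0 else 4 * c + 3),
     Delta = (\<lambda>c. if c = 0 then {(4 * s, qact_action a, 4 * t) | s a t. (s, a, t) \<in> E}
       else {(4 * c + 1, Guard [Eq 0 0], 4 * c + 2), (4 * c + 2, Assign 0 c, 4 * c + 3)})\<rparr>"

lemma qdas_of_simps [simp]:
  "Dom (qdas_of M N s0 E) = {..N}" "dinit (qdas_of M N s0 E) = 1"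
  "Vars (qdas_of M N s0 E) = {0}" "CQID (qdas_of M N s0 E) = {}"
  "SQID (qdas_of M N s0 E) = {0}" "Blocks (qdas_of M N s0 E) = {..N}"
  "main (qdas_of M N s0 E) = 0"
  by (simp_all add: qdas_of_def)

lemma qdas_of_main [simp]:
  "States (qdas_of M N s0 E) 0 = {4 * i | i. i \<le> M}"
  "sinit (qdas_of M N s0 E) 0 = 4 * s0"
  "sfinal (qdas_of M N s0 E) 0 = 0"
  "Delta (qdas_of M N s0 E) 0 = {(4 * s, qact_action a, 4 * t) | s a t. (s, a, t) \<in> E}"
  by (simp_all add: qdas_of_def)

lemma qdas_of_letter [simp]:
  assumes "0 < c"
  shows "States (qdas_of M N s0 E) c = {4 * c + 1, 4 * c + 2, 4 * c + 3}"
    "sinit (qdas_of M N s0 E) c = 4 * c + 1"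
    "sfinal (qdas_of M N s0 E) c = 4 * c + 3"
    "Delta (qdas_of M N s0 E) c =
      {(4 * c + 1, Guard [Eq 0 0], 4 * c + 2), (4 * c + 2, Assign 0 c, 4 * c + 3)}"
  using assms by (simp_all add: qdas_of_def)

text \<open>Residues modulo 4 keep the state sets disjoint: main uses multiples of 4, and block
  \<open>c\<close> uses \<open>4 * c\<close> plus 1, 2 or 3. The initial value 1 lies in the domain
  as \<open>0 < N\<close>; being nonzero, it is no request.\<close>

lemma is_qdas_qdas_of:
  assumes "is_qmachine M N E" "s0 \<le> M" "0 < N"
  shows "is_qdas (qdas_of M N s0 E)"
proof -
  let ?A = "qdas_of M N s0 E"
  have E: "finite E" "\<And>s a t. (s, a, t) \<in> E \<Longrightarrow> s \<le> M \<and> t \<le> M \<and> act_over N a"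
    using assms(1) by (auto simp: is_qmachine_def)
  have over: "action_over ?A (qact_action a)" if "act_over N a" for a
    using that by (cases a) auto
  have disj: "States ?A \<gamma> \<inter> States ?A \<gamma>' = {}" if "\<gamma> \<noteq> \<gamma>'" for \<gamma> \<gamma>'
    using that by (cases "\<gamma> = 0"; cases "\<gamma>' = 0") (auto, presburger+)
  have "finite (States ?A \<gamma>) \<and> sinit ?A \<gamma> \<in> States ?A \<gamma> \<and> sfinal ?A \<gamma> \<in> States ?A \<gamma> \<and>
        finite (Delta ?A \<gamma>) \<and>
        (\<forall>(s, a, s') \<in> Delta ?A \<gamma>. s \<in> States ?A \<gamma> \<and> action_over ?A a \<and> s' \<in> States ?A \<gamma>)"
    if "\<gamma> \<in> Blocks ?A" for \<gamma>
  proof (cases "\<gamma> = 0")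
    case True
    have "{(4 * s, qact_action a, 4 * t) | s a t. (s, a, t) \<in> E} =
        (\<lambda>(s, a, t). (4 * s, qact_action a, 4 * t)) ` E" by force
    then have "finite (Delta ?A 0)" using E(1) by simp
    moreover have "finite {4 * i | i. i \<le> M}" by simp
    ultimately show ?thesis using True assms(2) by (auto dest!: E(2) over)
  next
    case False
    then show ?thesis using that by auto
  qed
  then show ?thesis
    unfolding is_qdas_def using assms(3) disj by simp
qed

lemma asynchronous_qdas_of: "asynchronous (qdas_of M N s0 E)"
proof -
  have "qact_action a \<noteq> DispatchS q c" for a q c by (cases a) auto
  moreover have "Delta (qdas_of M N s0 E) c = (if c = 0 then
     {(4 * s, qact_action a, 4 * t) | s a t. (s, a, t) \<in> E}
     else {(4 * c + 1, Guard [Eq 0 0], 4 * c + 2), (4 * c + 2, Assign 0 c, 4 * c + 3)})" for c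
    by simp
  ultimately show ?thesis unfolding asynchronous_def by (auto split: if_splits)
qed

text \<open>
  The running letter block, if any, is given by its vertex \<open>v\<close> and its progress \<open>k\<close>. Until it has
  written its answer at \<open>k = 3\<close>, its letter counts as the head of the queue.
\<close>

fun pending :: "(nat \<times> nat) option \<Rightarrow> nat list" where
  "pending None = []"
| "pending (Some (v, k)) = (if k < 3 then [v] else [])"

text \<open>A letter block past its guard must still find the variable at 0 when it writes, or its
  assignment would not be a \<open>serve\<close> step; hence the condition on \<open>k = 2\<close>.
  Vertex 0 is the main task.\<close>

definition represents :: "nat \<Rightarrow> (nat \<times> nat) option \<Rightarrow>
    (nat, nat, nat) ctg \<times> (nat \<Rightarrow> nat) \<Rightarrow> nat \<times> nat \<times> nat list \<Rightarrow> bool" where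
  "represents N T = (\<lambda>(G, val) (s, x, w).
     tasks G = insert 0 (fst ` set_option T) \<and> waits G = {} \<and> val 0 = x \<and>
     w = map (block G) (pending T @ fifo G 0) \<and> (\<forall>q. q \<noteq> 0 \<longrightarrow> fifo G q = []) \<and>
     distinct (fifo G 0) \<and> block G 0 = 0 \<and> queue G 0 = None \<and> state G 0 = 4 * s \<and>
     (\<forall>v\<in>set (fifo G 0). v \<noteq> 0 \<and> 0 < block G v \<and> block G v \<le> N \<and> queue G v = Some 0 \<and>
        state G v = 4 * block G v + 1) \<and>
     (\<forall>(v, k)\<in>set_option T. v \<noteq> 0 \<and> 0 < block G v \<and> block G v \<le> N \<and> queue G v = Some 0 \<and>
        v \<notin> set (fifo G 0) \<and> state G v = 4 * block G v + k \<and> k \<in> {1, 2, 3} \<and>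
        (k = 2 \<longrightarrow> x = 0)))"

lemma verts_represents:
  assumes "represents N T (G, val) (s, x, w)"
  shows "verts G = insert 0 (fst ` set_option T \<union> set (fifo G 0))"
proof -
  have "\<And>q. q \<noteq> 0 \<Longrightarrow> fifo G q = []" "tasks G = insert 0 (fst ` set_option T)"
    using assms unfolding represents_def by auto
  moreover from this have "set (fifo G q) \<subseteq> set (fifo G 0)" for q by (cases "q = 0") auto
  then have "(\<Union>q. set (fifo G q)) = set (fifo G 0)" by blast
  ultimately show ?thesis by (simp add: verts_def)
qed

text \<open>An invariant that rules out branching: while the variable is 0, the control has only
  \<open>Got\<close> edges, none of which matches 0, so \<open>serve\<close> is the only possible
  move.\<close>

fun answers_first :: "qmachine \<Rightarrow> nat \<times> nat \<times> nat list \<Rightarrow> bool" where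
  "answers_first E (s, x, w) \<longleftrightarrow>
     0 \<notin> set w \<and> (x = 0 \<longrightarrow> (\<forall>a t. (s, a, t) \<in> E \<longrightarrow> (\<exists>c. a = Got c)))"

lemma qmachine_letters:
  assumes "is_qmachine M N E"
  shows "(s, Put c, t) \<in> E \<Longrightarrow> 0 < c \<and> c \<le> N" "(s, Got c, t) \<in> E \<Longrightarrow> 0 < c \<and> c \<le> N"
  using assms unfolding is_qmachine_def by fastforce+

lemma answers_first_step:
  assumes "is_qmachine M N E" "qstep E a b" "answers_first E a"
  shows "answers_first E b"
  using assms(2,3)
proof cases
  case (ask s t x w)
  then show ?thesis using assms(1,3) unfolding is_qmachine_def by auto
qed (use assms(3) in \<open>auto dest: qmachine_letters[OF assms(1)]\<close>)

text \<open>Each step of the system is matched by at most one step of the machine. Dequeuing, the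
  guard of a letter and its removal are invisible; its assignment is \<open>serve\<close>. The case
  \<open>s = 0\<close> is excluded because main could then be removed.\<close>

lemma simulated_step:
  assumes E: "is_qmachine M N E" and step: "step (qdas_of M N s0 E) c c'"
    and rep: "represents N T c (s, x, w)" and s: "s \<noteq> 0"
    and af: "answers_first E (s, x, w)"
  shows "\<exists>T' a. represents N T' c' a \<and> (qstep E)\<^sup>*\<^sup>* (s, x, w) a"
proof -
  let ?A = "qdas_of M N s0 E"
  note letters = qmachine_letters[OF E]
  have task: "v = 0 \<or> (\<exists>k. T = Some (v, k) \<and> 0 < block G v)"
    if "v \<in> tasks G" "represents N T (G, val) (s, x, w)" for v G val
    using that unfolding represents_def by auto
  from step show ?thesis
  proof cases
    case (guard G v as s' val)
    note r = rep[unfolded guard]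
    from guard have v: "v \<in> tasks G" and D: "(state G v, Guard as, s') \<in> Delta ?A (block G v)"
      by (auto simp: can_fire_def)
    from task[OF v r] show ?thesis
    proof
      assume "v = 0"
      then obtain a t where a: "(s, a, t) \<in> E" "qact_action a = Guard as" "s' = 4 * t"
        using D r by (auto simp: represents_def)
      then obtain k where "a = Got k" "as = [Eq 0 k]" by (cases a) auto
      then have "qstep E (s, x, w) (t, x, w)" "represents N T c' (t, x, w)"
        using a guard r \<open>v = 0\<close> by (auto simp: represents_def move_def intro: qstep.got)
      then show ?thesis by blast
    next
      assume "\<exists>k. T = Some (v, k) \<and> 0 < block G v"
      then obtain k where k: "T = Some (v, k)" "0 < block G v" by blast
      then have "k = 1" "s' = 4 * block G v + 2" "x = 0"
        using D r guard by (auto simp: represents_def)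
      then have "represents N (Some (v, 2)) c' (s, x, w)"
        using guard r k by (auto simp: represents_def move_def)
      then show ?thesis by blast
    qed
  next
    case (assign G v y d s' val)
    note r = rep[unfolded assign]
    from assign have v: "v \<in> tasks G" and D: "(state G v, Assign y d, s') \<in> Delta ?A (block G v)"
      by (auto simp: can_fire_def)
    from task[OF v r] show ?thesis
    proof
      assume "v = 0"
      then obtain a t where a: "(s, a, t) \<in> E" "qact_action a = Assign y d" "s' = 4 * t"
        using D r by (auto simp: represents_def)
      then have "a = Ask" "y = 0" "d = 0" by (cases a; simp)+
      then have "qstep E (s, x, w) (t, 0, w)" "represents N T c' (t, 0, w)"
        using a assign r \<open>v = 0\<close> by (auto simp: represents_def move_def intro: qstep.ask)
      then show ?thesis by blast
    next
      assume "\<exists>k. T = Some (v, k) \<and> 0 < block G v"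
      then obtain k where k: "T = Some (v, k)" "0 < block G v" by blast
      then have "k = 2" "s' = 4 * block G v + 3" "x = 0" "y = 0" "d = block G v"
        using D r assign by (auto simp: represents_def)
      moreover from this have "w = d # map (block G) (fifo G 0)"
        using r k by (auto simp: represents_def)
      ultimately have "qstep E (s, x, w) (s, d, map (block G) (fifo G 0))"
        "represents N (Some (v, 3)) c' (s, d, map (block G) (fifo G 0))"
        using assign r k by (auto simp: represents_def move_def intro: qstep.serve)
      then show ?thesis by blast
    qed
  next
    case (dispatch_a G v q \<gamma> s' u val)
    note r = rep[unfolded dispatch_a]
    from dispatch_a have v: "v \<in> tasks G"
      and D: "(state G v, DispatchA q \<gamma>, s') \<in> Delta ?A (block G v)"
      by (auto simp: can_fire_def)
    from task[OF v r] show ?thesis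
    proof
      assume "v = 0"
      then obtain a t where a: "(s, a, t) \<in> E" "qact_action a = DispatchA q \<gamma>" "s' = 4 * t"
        using D r by (auto simp: represents_def)
      then have a': "a = Put \<gamma>" "q = 0" by (cases a; simp)+
      then have \<gamma>: "0 < \<gamma>" "\<gamma> \<le> N" using letters a(1) by auto
      have u: "u \<noteq> 0" "u \<notin> set (fifo G 0)" "u \<notin> fst ` set_option T"
        using verts_represents[OF r] dispatch_a by auto
      have "w @ [\<gamma>] = map ((block G)(u := \<gamma>)) (pending T @ fifo G 0 @ [u])"
        using u r by (cases T) (auto simp: represents_def)
      then have "represents N T c' (t, x, w @ [\<gamma>])"
        using a a' dispatch_a r \<open>v = 0\<close> \<gamma> u
        by (auto simp: represents_def move_def enqueue_def)
      moreover have "qstep E (s, x, w) (t, x, w @ [\<gamma>])"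
        using a a' by (auto intro: qstep.put)
      ultimately show ?thesis by blast
    next
      assume "\<exists>k. T = Some (v, k) \<and> 0 < block G v"
      then show ?thesis using D by auto
    qed
  next
    case (dispatch_s G v q \<gamma> s' u val)
    note r = rep[unfolded dispatch_s]
    from dispatch_s have v: "v \<in> tasks G"
      and D: "(state G v, DispatchS q \<gamma>, s') \<in> Delta ?A (block G v)"
      by (auto simp: can_fire_def)
    have neq: "DispatchS q \<gamma> \<noteq> qact_action a" for a by (cases a) auto
    from task[OF v r] have False
    proof
      assume "v = 0"
      then show False using D r neq by (auto simp: represents_def)
    next
      assume "\<exists>k. T = Some (v, k) \<and> 0 < block G v"
      then show False using D by auto
    qed
    then show ?thesis ..
  next
    case (finish v G val)
    note r = rep[unfolded finish]
    from task[OF finish(3) r] show ?thesis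
    proof
      assume "v = 0"
      then show ?thesis using finish r s by (auto simp: represents_def)
    next
      assume "\<exists>k. T = Some (v, k) \<and> 0 < block G v"
      then obtain k where k: "T = Some (v, k)" "0 < block G v" by blast
      then have "k = 3" using finish r by (auto simp: represents_def)
      then have "represents N None c' (s, x, w)"
        using finish r k by (auto simp: represents_def)
      then show ?thesis by blast
    qed
  next
    case (start_concurrent q G u ws val)
    then show ?thesis by simp
  next
    case (start_serial q G u ws val)
    note r = rep[unfolded start_serial]
    have "T = None" using start_serial r by (cases T) (auto simp: represents_def)
    then have "represents N (Some (u, 1)) c' (s, x, w)"
      using start_serial r by (auto simp: represents_def)
    then show ?thesis by blast
  qed
qed

lemma init_represents:
  "represents N None (init_config (qdas_of M N s0 E)) (s0, 1, [])"
  by (simp add: represents_def init_config_def)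

text \<open>Once main sits in state 0 it may finish, and a graph without vertex 0 represents
  nothing. Simulation is therefore claimed only when the machine never reaches 0, which suffices for
  a proof by contradiction.\<close>

lemma reachable_represents:
  assumes E: "is_qmachine M N E" and reach: "reachable (qdas_of M N s0 E) c"
    and no_halt: "\<And>x w. \<not> (qstep E)\<^sup>*\<^sup>* (s0, 1, []) (0, x, w)"
  shows "\<exists>T a. represents N T c a \<and> (qstep E)\<^sup>*\<^sup>* (s0, 1, []) a"
  using reach unfolding reachable_def
proof (induction rule: rtranclp_induct)
  case base
  show ?case using init_represents by blast
next
  case (step c c')
  then obtain T s x w where IH: "represents N T c (s, x, w)" "(qstep E)\<^sup>*\<^sup>* (s0, 1, []) (s, x, w)"
    by (metis prod_cases3)
  have "answers_first E (s, x, w)"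
    using IH(2)
    by (induction rule: rtranclp_induct) (use answers_first_step[OF E] in auto)
  moreover have "s \<noteq> 0" using IH(2) no_halt by metis
  ultimately show ?case
    using simulated_step[OF E step.hyps(2) IH(1)] IH(2) by (meson rtranclp_trans)
qed

text \<open>A \<open>serve\<close> is played out at once as dequeue, guard, answer and finish, so
  that between machine steps no letter task is running.\<close>

lemma simulating_steps:
  assumes E: "is_qmachine M N E" and rep: "represents N None c a" and q: "qstep E a b"
  shows "\<exists>c'. (step (qdas_of M N s0 E))\<^sup>*\<^sup>* c c' \<and> represents N None c' b"
proof -
  let ?A = "qdas_of M N s0 E"
  obtain G val where c: "c = (G, val)" by (cases c)
  have main: "can_fire ?A G 0 (qact_action e) (4 * t)" if "(fst a, e, t) \<in> E" for e t
    using rep that c by (cases a) (auto simp: can_fire_def unblocked_def represents_def)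
  from q show ?thesis
  proof cases
    case (put s d t x w)
    have d: "0 < d" "d \<le> N" using qmachine_letters(1)[OF E put(3)] by auto
    have V: "verts G = insert 0 (set (fifo G 0))"
      using verts_represents rep unfolding c put by force
    then have "finite (verts G)" by simp
    then obtain u where u: "u \<notin> verts G" using ex_new_if_finite infinite_UNIV_nat by blast
    let ?G = "enqueue ?A 0 d u (move 0 (4 * t) G)"
    have "step ?A c (?G, val)"
      unfolding c using main[of "Put d" t] put u by (auto intro: step.dispatch_a)
    moreover have "represents N None (?G, val) b"
      using rep u V d unfolding c put by (auto simp: represents_def move_def enqueue_def)
    ultimately show ?thesis by blast
  next
    case (ask s t x w)
    have "step ?A c (move 0 (4 * t) G, val(0 := 0))"
      unfolding c using main[of Ask t] ask by (auto intro: step.assign)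
    moreover have "represents N None (move 0 (4 * t) G, val(0 := 0)) b"
      using rep unfolding c ask by (auto simp: represents_def move_def)
    ultimately show ?thesis by blast
  next
    case (got s d t w)
    have "step ?A c (move 0 (4 * t) G, val)"
      unfolding c by (rule step.guard[where as = "[Eq 0 d]"])
        (use main[of "Got d" t] got rep c in \<open>auto simp: represents_def\<close>)
    moreover have "represents N None (move 0 (4 * t) G, val) b"
      using rep unfolding c got by (auto simp: represents_def move_def)
    ultimately show ?thesis by blast
  next
    case (serve s d w)
    note r = rep[unfolded c serve]
    then obtain u us where u: "fifo G 0 = u # us" "block G u = d" "w = map (block G) us"
      by (auto simp: represents_def)
    have u0: "u \<noteq> 0" "0 < d" "d \<le> N" "state G u = 4 * d + 1" "u \<notin> set us"
      using r u by (auto simp: represents_def)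
    let ?G1 = "G\<lparr>tasks := insert u (tasks G), fifo := (fifo G)(0 := us)\<rparr>"
    let ?G2 = "move u (4 * d + 2) ?G1" and ?G3 = "move u (4 * d + 3) (move u (4 * d + 2) ?G1)"
    let ?G4 = "?G3\<lparr>tasks := tasks ?G3 - {u}, waits := {e \<in> waits ?G3. snd e \<noteq> u}\<rparr>"
    have w: "waits G = {}" "tasks G = {0}" "val 0 = 0" using r by (auto simp: represents_def)
    have s1: "step ?A (G, val) (?G1, val)"
      by (rule step.start_serial) (use u r in \<open>auto simp: represents_def\<close>)
    have s2: "step ?A (?G1, val) (?G2, val)"
      by (rule step.guard[where as = "[Eq 0 0]"])
        (use u u0 w in \<open>auto simp: can_fire_def unblocked_def\<close>)
    have s3: "step ?A (?G2, val) (?G3, val(0 := d))"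
      by (rule step.assign) (use u u0 w in \<open>auto simp: can_fire_def unblocked_def move_def\<close>)
    have s4: "step ?A (?G3, val(0 := d)) (?G4, val(0 := d))"
      by (rule step.finish) (use u u0 w in \<open>auto simp: unblocked_def move_def\<close>)
    have "(step ?A)\<^sup>*\<^sup>* c (?G4, val(0 := d))"
      unfolding c using s1 s2 s3 s4
      by (blast intro: converse_rtranclp_into_rtranclp)
    moreover have "represents N None (?G4, val(0 := d)) b"
      using r u u0 w unfolding serve by (auto simp: represents_def move_def)
    ultimately show ?thesis by blast
  qed
qed

definition halting_target :: "nat \<Rightarrow> nat" where
  "halting_target s = (if s = 0 then 1 else 0)"

theorem parikh_coverable_iff_halting:
  assumes E: "is_qmachine M N E" and s0: "s0 \<le> M"
  shows "parikh_coverable (qdas_of M N s0 E) halting_target \<longleftrightarrow>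
    (\<exists>x w. (qstep E)\<^sup>*\<^sup>* (s0, 1, []) (0, x, w))"
proof
  let ?A = "qdas_of M N s0 E"
  have "(0::nat) \<in> States ?A 0" by auto
  then have zero: "0 \<in> all_states ?A" unfolding all_states_def by force
  assume "parikh_coverable ?A halting_target"
  then obtain G val where reach: "reachable ?A (G, val)" and "1 \<le> Parikh G 0"
    using zero unfolding parikh_coverable_def halting_target_def by force
  then have "{v \<in> verts G. state G v = 0} \<noteq> {}"
    unfolding Parikh_def by (metis card.empty not_one_le_zero)
  then obtain v where v: "v \<in> verts G" "state G v = 0" by blast
  show "\<exists>x w. (qstep E)\<^sup>*\<^sup>* (s0, 1, []) (0, x, w)"
  proof (rule ccontr)
    assume no_halt: "\<not> ?thesis"
    then obtain T s x w where *: "represents N T (G, val) (s, x, w)"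
        "(qstep E)\<^sup>*\<^sup>* (s0, 1, []) (s, x, w)"
      using reachable_represents[OF E reach] by (metis prod_cases3)
    \<comment> \<open>A letter vertex has state \<open>4 * c + k\<close> with \<open>c\<close>
      positive, so a vertex in state 0 must be main.\<close>
    then have "s = 0" using v verts_represents[OF *(1)] by (auto simp: represents_def)
    then show False using * no_halt by blast
  qed
next
  let ?A = "qdas_of M N s0 E"
  assume "\<exists>x w. (qstep E)\<^sup>*\<^sup>* (s0, 1, []) (0, x, w)"
  then obtain x w where "(qstep E)\<^sup>*\<^sup>* (s0, 1, []) (0, x, w)" by blast
  then have "\<exists>c. (step ?A)\<^sup>*\<^sup>* (init_config ?A) c \<and> represents N None c (0, x, w)"
  proof (induction rule: rtranclp_induct)
    case base
    show ?case using init_represents by blast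
  next
    case (step b b')
    then show ?case using simulating_steps[OF E] by (meson rtranclp_trans)
  qed
  then obtain G val where r: "reachable ?A (G, val)" "represents N None (G, val) (0, x, w)"
    unfolding reachable_def by force
  have "finite (verts G)" "0 \<in> verts G" "state G 0 = 0"
    using r(2) verts_represents[OF r(2)] by (auto simp: represents_def)
  then have "0 < Parikh G 0" unfolding Parikh_def by (auto simp: card_gt_0_iff)
  then show "parikh_coverable ?A halting_target"
    using r(1) unfolding parikh_coverable_def halting_target_def
    by (intro exI[of _ G] exI[of _ val]) auto
qed

section \<open>Loop programs on queue machines\<close>

definition deterministic :: "qmachine \<Rightarrow> bool" where
  "deterministic E \<longleftrightarrow> (\<forall>s a t a' t'. (s, a, t) \<in> E \<longrightarrow> (s, a', t') \<in> E \<longrightarrow>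
     a = a' \<and> t = t' \<or> (\<exists>c c'. a = Got c \<and> a' = Got c' \<and> c \<noteq> c'))"

lemma deterministicD:
  "deterministic E \<Longrightarrow> (s, a, t) \<in> E \<Longrightarrow> (s, a', t') \<in> E \<Longrightarrow>
     a = a' \<and> t = t' \<or> (\<exists>c c'. a = Got c \<and> a' = Got c' \<and> c \<noteq> c')"
  unfolding deterministic_def by blast

lemma deterministic_Un:
  assumes "deterministic E" "deterministic F" "fst ` E \<inter> fst ` F = {}"
  shows "deterministic (E \<union> F)"
proof -
  have "(s, a, t) \<in> E \<Longrightarrow> (s, a', t') \<notin> F" for s a t a' t'
    using assms(3) by force
  then show ?thesis
    using assms(1,2) unfolding deterministic_def by (metis Un_iff)
qed

lemma qstep_deterministic:
  assumes "is_qmachine M N E" "deterministic E" "answers_first E a" "qstep E a b" "qstep E a b'"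
  shows "b' = b"
  using assms(4,5,3)
  by (elim qstep.cases)
    (auto dest: deterministicD[OF assms(2)] qmachine_letters[OF assms(1)])

text \<open>This turns one known run into a statement on all runs: a configuration reached elsewhere
  lies before or after the known one.\<close>

lemma qsteps_linear:
  assumes "is_qmachine M N E" "deterministic E"
    and "(qstep E)\<^sup>*\<^sup>* a b" "(qstep E)\<^sup>*\<^sup>* a c" "answers_first E a"
  shows "(qstep E)\<^sup>*\<^sup>* b c \<or> (qstep E)\<^sup>*\<^sup>* c b"
  using assms(3-5)
proof (induction rule: converse_rtranclp_induct)
  case base
  then show ?case by blast
next
  case (step a a')
  from step.prems(1) show ?case
  proof (cases rule: converse_rtranclpE)
    case base
    then show ?thesis using step.hyps by (meson converse_rtranclp_into_rtranclp)
  next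
    case (step a'')
    then have "a'' = a'"
      using qstep_deterministic[OF assms(1,2)] \<open>qstep E a a'\<close> \<open>answers_first E a\<close> by blast
    then show ?thesis
      using step \<open>qstep E a a'\<close> \<open>answers_first E a\<close> answers_first_step[OF assms(1)] step.IH
      by blast
  qed
qed

text \<open>The queue may still be served, so the configuration need not be final; only the control
  state is frozen.\<close>

lemma qsteps_stuck:
  assumes "(qstep E)\<^sup>*\<^sup>* (s, x, w) (s', x', w')" "\<And>a t. (s, a, t) \<notin> E"
  shows "s' = s"
proof -
  have "fst b = s" if "(qstep E)\<^sup>*\<^sup>* (s, x, w) b" for b
    using that by (induction rule: rtranclp_induct) (auto elim!: qstep.cases simp: assms(2))
  then show ?thesis using assms(1) by fastforce
qed

text \<open>
  Control states are pairs of a program location and a phase. The letter \<open>1\<close> is an end marker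
  and the letter \<open>i + 2\<close> is a unit of register \<open>i\<close>, so the order of the queue does not matter.
  To decrement register \<open>i\<close>, the machine appends the marker and rotates the queue until it meets
  \<open>i + 2\<close> (phases 1 and 2), which it drops, going on to rotate up to the marker (phases 3 and 4).
\<close>

abbreviation at :: "nat \<Rightarrow> nat \<Rightarrow> nat" where
  "at l k \<equiv> prod_encode (l, k)"

text \<open>A letter that is being moved to the back is remembered in the phase:
  \<open>2 * j + 5\<close> during the search and \<open>2 * j + 6\<close> after the removal. Parity
  separates the two, and both lie above the fixed phases 0 to 4. Meeting the marker in phase 2 shows
  that the register is 0.\<close>

definition decrement_edges :: "nat \<Rightarrow> nat \<Rightarrow> nat \<Rightarrow> nat \<Rightarrow> nat \<Rightarrow> qmachine" where
  "decrement_edges K i l nonzero zero =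
     {(at l 0, Put 1, at l 1), (at l 1, Ask, at l 2), (at l 2, Got (i + 2), at l 3),
      (at l 2, Got 1, at zero 0), (at l 3, Ask, at l 4), (at l 4, Got 1, at nonzero 0)} \<union>
     (\<lambda>j. (at l 2, Got (j + 2), at l (2 * j + 5))) ` ({..<K} - {i}) \<union>
     (\<lambda>j. (at l (2 * j + 5), Put (j + 2), at l 1)) ` {..<K} \<union>
     (\<lambda>j. (at l 4, Got (j + 2), at l (2 * j + 6))) ` {..<K} \<union>
     (\<lambda>j. (at l (2 * j + 6), Put (j + 2), at l 3)) ` {..<K}"

text \<open>The two extra locations of a loop are its head and the point after its body from which
  it jumps back.\<close>

primrec locs :: "prog \<Rightarrow> nat" where
  "locs Skip = 0"
| "locs (Inc i) = 1"
| "locs (Seq p q) = locs p + locs q"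
| "locs (Loop i p) = locs p + 2"

primrec regs :: "prog \<Rightarrow> nat set" where
  "regs Skip = {}"
| "regs (Inc i) = {i}"
| "regs (Seq p q) = regs p \<union> regs q"
| "regs (Loop i p) = insert i (regs p)"

text \<open>A fragment is entered at phase 0 of \<open>l\<close> and left at phase 0 of
  \<open>l + locs p\<close>, so sequencing needs no connecting edges.\<close>

primrec edges :: "nat \<Rightarrow> prog \<Rightarrow> nat \<Rightarrow> qmachine" where
  "edges K Skip l = {}"
| "edges K (Inc i) l = {(at l 0, Put (i + 2), at (l + 1) 0)}"
| "edges K (Seq p q) l = edges K p l \<union> edges K q (l + locs p)"
| "edges K (Loop i p) l = decrement_edges K i l (l + 1) (l + locs p + 2) \<union>
     edges K p (l + 1) \<union> {(at (l + 1 + locs p) 0, Put 1, at l 1)}"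

lemma finite_regs: "finite (regs p)"
  by (induction p) auto

lemma finite_decrement_edges: "finite (decrement_edges K i l nz z)"
  by (simp add: decrement_edges_def)

lemma finite_edges: "finite (edges K p l)"
  by (induction p arbitrary: l) (simp_all add: finite_decrement_edges)

lemma decrement_edges_source: "(s, a, t) \<in> decrement_edges K i l nz z \<Longrightarrow> \<exists>k. s = at l k"
  by (auto simp: decrement_edges_def)

lemma edges_source: "(s, a, t) \<in> edges K p l \<Longrightarrow> \<exists>l' k. s = at l' k \<and> l \<le> l' \<and> l' < l + locs p"
proof (induction p arbitrary: l)
  case (Seq p q)
  then show ?case by fastforce
next
  case (Loop i p)
  then show ?case by (fastforce dest: decrement_edges_source)
qed auto

lemma deterministic_decrement_edges: "deterministic (decrement_edges K i l nz z)"
proof -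
  let ?singles = "{(at l 0, Put 1, at l 1), (at l 1, Ask, at l 2), (at l 3, Ask, at l 4)}"
  let ?two = "insert (at l 2, Got (i + 2), at l 3) (insert (at l 2, Got 1, at z 0)
     ((\<lambda>j. (at l 2, Got (j + 2), at l (2 * j + 5))) ` ({..<K} - {i})))"
  let ?four = "insert (at l 4, Got 1, at nz 0)
     ((\<lambda>j. (at l 4, Got (j + 2), at l (2 * j + 6))) ` {..<K})"
  let ?odd = "(\<lambda>j. (at l (2 * j + 5), Put (j + 2), at l 1)) ` {..<K}"
  let ?even = "(\<lambda>j. (at l (2 * j + 6), Put (j + 2), at l 3)) ` {..<K}"
  have "deterministic ?singles" "deterministic ?two" "deterministic ?four" "deterministic ?odd"
    "deterministic ?even"
    by (auto simp: deterministic_def)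
  moreover have "fst ` ?odd \<inter> fst ` ?even = {}"
    by (auto simp: image_iff) presburger
  ultimately have "deterministic (?singles \<union> (?two \<union> (?four \<union> (?odd \<union> ?even))))"
    by (intro deterministic_Un) (auto simp: image_iff)
  moreover have "?singles \<union> (?two \<union> (?four \<union> (?odd \<union> ?even))) = decrement_edges K i l nz z"
    unfolding decrement_edges_def by blast
  ultimately show ?thesis by simp
qed

lemma deterministic_edges: "deterministic (edges K p l)"
proof (induction p arbitrary: l)
  case (Seq p q)
  then show ?case unfolding edges.simps
    by (intro deterministic_Un) (auto dest!: edges_source)
next
  case (Loop i p)
  have "deterministic {(at (l + 1 + locs p) 0, Put 1, at l 1)}" by (simp add: deterministic_def)
  then show ?case unfolding edges.simps
    by (intro deterministic_Un Loop.IH deterministic_decrement_edges)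
      (auto dest!: edges_source decrement_edges_source)
qed (auto simp: deterministic_def)

text \<open>Phases 2 and 4 wait for a letter.\<close>

definition disciplined :: "qmachine \<Rightarrow> bool" where
  "disciplined E \<longleftrightarrow> (\<forall>(s, a, t) \<in> E. (a = Ask \<longrightarrow> snd (prod_decode t) \<in> {2, 4}) \<and>
     (snd (prod_decode s) \<in> {2, 4} \<longrightarrow> (\<exists>c. a = Got c)))"

lemma disciplined_decrement_edges: "disciplined (decrement_edges K i l nz z)"
  unfolding disciplined_def decrement_edges_def by auto

lemma disciplinedD:
  "disciplined E \<Longrightarrow> (s, Ask, t) \<in> E \<Longrightarrow> (t, a, t') \<in> E \<Longrightarrow> \<exists>c. a = Got c"
  unfolding disciplined_def by blast

lemma disciplined_Un: "disciplined (E \<union> F) \<longleftrightarrow> disciplined E \<and> disciplined F"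
  unfolding disciplined_def by blast

lemma disciplined_edges: "disciplined (edges K p l)"
  by (induction p arbitrary: l)
    (simp_all only: edges.simps disciplined_Un disciplined_decrement_edges, auto simp: disciplined_def)

lemma decrement_edges_letters:
  "(s, a, t) \<in> decrement_edges K i l nz z \<Longrightarrow> a \<noteq> Put 0 \<and> a \<noteq> Got 0"
  by (auto simp: decrement_edges_def)

lemma edges_letters: "(s, a, t) \<in> edges K p l \<Longrightarrow> a \<noteq> Put 0 \<and> a \<noteq> Got 0"
  by (induction p arbitrary: l) (auto dest: decrement_edges_letters)

section \<open>Executing loop programs by rotating the queue\<close>

definition holds_regs :: "nat \<Rightarrow> (nat \<Rightarrow> nat) \<Rightarrow> nat list \<Rightarrow> bool" where
  "holds_regs K \<sigma> w \<longleftrightarrow> set w \<subseteq> {2..<K + 2} \<and> (\<forall>i<K. count_list w (i + 2) = \<sigma> i)"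

lemma qstep_fetch:
  assumes "(p, Ask, q) \<in> E" "(q, Got c, t) \<in> E"
  shows "(qstep E)\<^sup>*\<^sup>* (p, x, c # w) (t, c, w)"
proof -
  have "qstep E (p, x, c # w) (q, 0, c # w)" by (rule qstep.ask) fact
  moreover have "qstep E (q, 0, c # w) (q, c, w)" by (rule qstep.serve)
  moreover have "qstep E (q, c, w) (t, c, w)" by (rule qstep.got) fact
  ultimately show ?thesis by (blast intro: converse_rtranclp_into_rtranclp)
qed

lemma qstep_rotate:
  assumes "(p, Ask, q) \<in> E"
    and "\<And>c. c \<in> set u \<Longrightarrow> (q, Got c, X c) \<in> E \<and> (X c, Put c, p) \<in> E"
  shows "\<exists>x'. (qstep E)\<^sup>*\<^sup>* (p, x, u @ v) (p, x', v @ u)"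
  using assms(2)
proof (induction u arbitrary: v x)
  case (Cons c u)
  have "(qstep E)\<^sup>*\<^sup>* (p, x, (c # u) @ v) (X c, c, u @ v)"
    using qstep_fetch[OF assms(1)] Cons.prems by simp
  moreover have "qstep E (X c, c, u @ v) (p, c, u @ (v @ [c]))"
    using qstep.put[of "X c" c p E c "u @ v"] Cons.prems by simp
  moreover obtain x' where "(qstep E)\<^sup>*\<^sup>* (p, c, u @ (v @ [c])) (p, x', (v @ [c]) @ u)"
    using Cons.IH[of c "v @ [c]"] Cons.prems by auto
  ultimately have "(qstep E)\<^sup>*\<^sup>* (p, x, (c # u) @ v) (p, x', (v @ [c]) @ u)"
    by (meson rtranclp_trans rtranclp.rtrancl_into_rtrancl)
  then show ?case by auto
qed auto

text \<open>If the letter is absent, a full rotation brings the marker to the front and leaves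
  \<open>w\<close> in order behind it. Otherwise \<open>w = u @ (i + 2) # v\<close>: rotating
  \<open>u\<close> and dropping the letter gives \<open>v @ 1 # u\<close>, rotating \<open>v\<close>
  gives \<open>1 # u @ v\<close>, and dropping the marker leaves \<open>u @ v\<close>.\<close>

lemma qstep_decrement:
  assumes E: "decrement_edges K i l nz z \<subseteq> E" and i: "i < K" and w: "holds_regs K \<sigma> w"
  shows "\<sigma> i = 0 \<Longrightarrow> (qstep E)\<^sup>*\<^sup>* (at l 1, x, w @ [1]) (at z 0, 1, w)"
    and "\<sigma> i = Suc m \<Longrightarrow> \<exists>w'. (qstep E)\<^sup>*\<^sup>* (at l 1, x, w @ [1]) (at nz 0, 1, w') \<and>
      holds_regs K (\<sigma>(i := m)) w'"
proof -
  have 1: "(at l 1, Ask, at l 2) \<in> E" "(at l 3, Ask, at l 4) \<in> E"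
    and 2: "(at l 2, Got (i + 2), at l 3) \<in> E" "(at l 2, Got 1, at z 0) \<in> E"
      "(at l 4, Got 1, at nz 0) \<in> E"
    using E by (auto simp: decrement_edges_def)
  define X where "X k c = at l (2 * (c - 2) + k)" for k c
  have letter: "\<exists>j<K. c = j + 2" if "2 \<le> c" "c < K + 2" for c
    by (rule exI[of _ "c - 2"]) (use that in auto)
  have 3: "(at l 2, Got c, X 5 c) \<in> E \<and> (X 5 c, Put c, at l 1) \<in> E"
    if "2 \<le> c" "c < K + 2" "c \<noteq> i + 2" for c
    using letter[OF that(1,2)] E that(3) by (auto simp: decrement_edges_def X_def)
  have 4: "(at l 4, Got c, X 6 c) \<in> E \<and> (X 6 c, Put c, at l 3) \<in> E"
    if "2 \<le> c" "c < K + 2" for c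
    using letter[OF that(1,2)] E by (auto simp: decrement_edges_def X_def)
  have set_w: "\<And>c. c \<in> set w \<Longrightarrow> 2 \<le> c \<and> c < K + 2" using w by (auto simp: holds_regs_def)
  have count: "count_list w (i + 2) = \<sigma> i" using w i by (auto simp: holds_regs_def)
  show "(qstep E)\<^sup>*\<^sup>* (at l 1, x, w @ [1]) (at z 0, 1, w)" if "\<sigma> i = 0"
  proof -
    have "i + 2 \<notin> set w" using count that by (simp add: count_list_0_iff)
    then obtain x' where "(qstep E)\<^sup>*\<^sup>* (at l 1, x, w @ [1]) (at l 1, x', [1] @ w)"
      using qstep_rotate[OF 1(1), of w "X 5" x "[1]"] 3 set_w by metis
    then show ?thesis using qstep_fetch[OF 1(1) 2(2), of x' w] by auto
  qed
  show "\<exists>w'. (qstep E)\<^sup>*\<^sup>* (at l 1, x, w @ [1]) (at nz 0, 1, w') \<and>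
      holds_regs K (\<sigma>(i := m)) w'" if \<sigma>: "\<sigma> i = Suc m"
  proof -
    have "i + 2 \<in> set w" using count \<sigma> by (metis count_list_0_iff nat.distinct(1))
    then obtain u v where uv: "w = u @ (i + 2) # v" "i + 2 \<notin> set u"
      by (meson split_list_first)
    obtain x1 where "(qstep E)\<^sup>*\<^sup>* (at l 1, x, u @ ((i + 2) # v @ [1]))
        (at l 1, x1, ((i + 2) # v @ [1]) @ u)"
      using qstep_rotate[OF 1(1), of u "X 5" x "(i + 2) # v @ [1]"] 3 set_w uv
      by (metis Un_iff set_append)
    moreover have "(qstep E)\<^sup>*\<^sup>* (at l 1, x1, (i + 2) # v @ 1 # u) (at l 3, i + 2, v @ 1 # u)"
      by (rule qstep_fetch[OF 1(1) 2(1)])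
    moreover obtain x2 where "(qstep E)\<^sup>*\<^sup>* (at l 3, i + 2, v @ (1 # u)) (at l 3, x2, (1 # u) @ v)"
      using qstep_rotate[OF 1(2), of v "X 6" "i + 2" "1 # u"] 4 set_w uv
      by (metis Un_iff list.set_intros(2) set_append)
    moreover have "(qstep E)\<^sup>*\<^sup>* (at l 3, x2, 1 # u @ v) (at nz 0, 1, u @ v)"
      by (rule qstep_fetch[OF 1(2) 2(3)])
    ultimately have "(qstep E)\<^sup>*\<^sup>* (at l 1, x, w @ [1]) (at nz 0, 1, u @ v)"
      using uv by simp
    moreover have "holds_regs K (\<sigma>(i := m)) (u @ v)"
      using w \<sigma> i unfolding holds_regs_def uv by (auto split: if_splits)
    ultimately show ?thesis by blast
  qed
qed

text \<open>A loop is re-entered at phase 1, the marker having been appended at the end of its body.\<close>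

lemma qstep_exec:
  assumes "exec p \<sigma> \<sigma>'" "edges K p l \<subseteq> E" "regs p \<subseteq> {..<K}" "holds_regs K \<sigma> w"
    and "c = (at l 0, x, w) \<or> (\<exists>i q. p = Loop i q) \<and> c = (at l 1, x, w @ [1])"
  shows "\<exists>x' w'. (qstep E)\<^sup>*\<^sup>* c (at (l + locs p) 0, x', w') \<and> holds_regs K \<sigma>' w'"
  using assms
proof (induction arbitrary: l w c x)
  case (skip \<sigma>)
  then show ?case by auto
next
  case (inc i \<sigma>)
  have "qstep E (at l 0, x, w) (at (l + 1) 0, x, w @ [i + 2])"
    using inc by (intro qstep.put) auto
  moreover have "holds_regs K (\<sigma>(i := Suc (\<sigma> i))) (w @ [i + 2])"
    using inc.prems by (auto simp: holds_regs_def)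
  moreover have "c = (at l 0, x, w)" using inc.prems(4) by simp
  ultimately show ?case using locs.simps(2) by (metis r_into_rtranclp)
next
  case (seq p \<sigma> \<sigma>' q \<sigma>'')
  obtain x1 w1 where "(qstep E)\<^sup>*\<^sup>* (at l 0, x, w) (at (l + locs p) 0, x1, w1)"
      "holds_regs K \<sigma>' w1"
    using seq.IH(1)[of l w "(at l 0, x, w)" x] seq.prems by auto
  moreover from this obtain x2 w2 where
    "(qstep E)\<^sup>*\<^sup>* (at (l + locs p) 0, x1, w1) (at (l + locs p + locs q) 0, x2, w2)"
      "holds_regs K \<sigma>'' w2"
    using seq.IH(2)[of "l + locs p" w1 "(at (l + locs p) 0, x1, w1)" x1] seq.prems by auto
  ultimately show ?case using seq.prems(4) by (auto simp: add.assoc intro: rtranclp_trans)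
next
  case (loop_done \<sigma> i p)
  have "(at l 0, Put 1, at l 1) \<in> E" using loop_done.prems(1) by (auto simp: decrement_edges_def)
  then have "qstep E (at l 0, x, w) (at l 1, x, w @ [1])" by (rule qstep.put)
  moreover have "(qstep E)\<^sup>*\<^sup>* (at l 1, x, w @ [1]) (at (l + locs p + 2) 0, 1, w)"
    by (rule qstep_decrement(1)[of K i l "l + 1" _ E \<sigma>]) (use loop_done in auto)
  ultimately have "(qstep E)\<^sup>*\<^sup>* c (at (l + locs p + 2) 0, 1, w)"
    using loop_done.prems(4) by (meson converse_rtranclp_into_rtranclp)
  then show ?case using loop_done.prems(3) by auto
next
  case (loop_step \<sigma> i m p \<sigma>' \<sigma>'')
  have "(at l 0, Put 1, at l 1) \<in> E" using loop_step.prems(1) by (auto simp: decrement_edges_def)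
  then have "qstep E (at l 0, x, w) (at l 1, x, w @ [1])" by (rule qstep.put)
  moreover have "\<exists>w'. (qstep E)\<^sup>*\<^sup>* (at l 1, x, w @ [1]) (at (l + 1) 0, 1, w') \<and>
      holds_regs K (\<sigma>(i := m)) w'"
    by (rule qstep_decrement(2)[of K i l "l + 1" "l + locs p + 2"]) (use loop_step in auto)
  ultimately obtain w1 where "(qstep E)\<^sup>*\<^sup>* c (at (l + 1) 0, 1, w1)"
      and 1: "holds_regs K (\<sigma>(i := m)) w1"
    using loop_step.prems(4) by (meson converse_rtranclp_into_rtranclp)
  moreover obtain x2 w2 where "(qstep E)\<^sup>*\<^sup>* (at (l + 1) 0, 1, w1) (at (l + 1 + locs p) 0, x2, w2)"
      and 2: "holds_regs K \<sigma>' w2"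
    using loop_step.IH(1)[of "l + 1" w1 "(at (l + 1) 0, 1, w1)" 1] loop_step.prems 1
    by (auto simp del: fun_upd_apply)
  moreover have "qstep E (at (l + 1 + locs p) 0, x2, w2) (at l 1, x2, w2 @ [1])"
    using loop_step.prems(1) by (intro qstep.put) auto
  moreover obtain x3 w3 where
    "(qstep E)\<^sup>*\<^sup>* (at l 1, x2, w2 @ [1]) (at (l + locs (Loop i p)) 0, x3, w3)"
    and 3: "holds_regs K \<sigma>'' w3"
    using loop_step.IH(2)[of l w2 "(at l 1, x2, w2 @ [1])" x2] loop_step.prems 2 by blast
  ultimately have "(qstep E)\<^sup>*\<^sup>* c (at (l + locs (Loop i p)) 0, x3, w3)"
    by (meson rtranclp_trans converse_rtranclp_into_rtranclp)
  then show ?case using 3 by blast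
qed

text \<open>
  The machine enters state \<open>0\<close> if \<open>p\<close> leaves \<open>0\<close> in register 1, and otherwise gets stuck in
  another state.
\<close>

definition program_edges :: "nat \<Rightarrow> prog \<Rightarrow> qmachine" where
  "program_edges K p = edges K p 1 \<union> decrement_edges K 1 (1 + locs p) (2 + locs p) 0"

text \<open>Started in state \<open>2 * n\<close>, this machine fills register \<open>0\<close> with \<open>n\<close> before running
  \<open>E\<close>; the letter \<open>3\<close> lands in the output register, where it does no harm.\<close>

definition with_input :: "nat \<Rightarrow> qmachine \<Rightarrow> qmachine" where
  "with_input n E = E \<union> {(n, Put 3, at 1 0)} \<union> (\<lambda>i. (n + i + 1, Put 2, n + i)) ` {..<n}"

lemma program_edges_facts:
  "finite (program_edges K p)" "disciplined (program_edges K p)" "deterministic (program_edges K p)"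
  "(s, a, t) \<in> program_edges K p \<Longrightarrow> a \<noteq> Put 0 \<and> a \<noteq> Got 0"
  "(s, a, t) \<in> program_edges K p \<Longrightarrow> \<exists>l k. s = at l k \<and> 0 < l \<and> l < 2 + locs p"
proof -
  show "finite (program_edges K p)"
    by (simp add: program_edges_def finite_edges finite_decrement_edges)
  show "disciplined (program_edges K p)"
    using disciplined_edges[of K p 1] disciplined_decrement_edges[of K 1 "1 + locs p" "2 + locs p" 0]
    unfolding program_edges_def disciplined_def by blast
  show "deterministic (program_edges K p)"
    unfolding program_edges_def
    by (intro deterministic_Un deterministic_edges deterministic_decrement_edges)
      (auto dest!: edges_source decrement_edges_source)
  show "(s, a, t) \<in> program_edges K p \<Longrightarrow> a \<noteq> Put 0 \<and> a \<noteq> Got 0"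
    unfolding program_edges_def by (auto dest: edges_letters decrement_edges_letters)
  show "\<exists>l k. s = at l k \<and> 0 < l \<and> l < 2 + locs p" if "(s, a, t) \<in> program_edges K p"
    using that unfolding program_edges_def
    by (fastforce dest: edges_source decrement_edges_source)
qed

text \<open>The strict bound on states leaves the numbers from \<open>n\<close> on free for the
  loading chain.\<close>

definition bounded_by :: "nat \<Rightarrow> qmachine \<Rightarrow> bool" where
  "bounded_by n E \<longleftrightarrow> (\<forall>(s, a, t) \<in> E. s < n \<and> t < n \<and> (\<forall>c. a = Put c \<or> a = Got c \<longrightarrow> c < n))"

lemma is_qmachine_with_input:
  assumes n: "bounded_by n (program_edges K p)" "3 \<le> n"
  shows "is_qmachine (2 * n) n (with_input n (program_edges K p))"
proof -
  let ?E = "program_edges K p"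
  have b: "s < n \<and> t < n \<and> (\<forall>c. a = Put c \<or> a = Got c \<longrightarrow> c < n)" if "(s, a, t) \<in> ?E" for s a t
    using that n(1) unfolding bounded_by_def by blast
  have 1: "act_over n a" if "(s, a, t) \<in> ?E" for s a t
    using b[OF that] program_edges_facts(4)[OF that] by (cases a) auto
  have at1: "at 1 0 = 2" by (simp add: prod_encode_def)
  have 2: "s \<le> 2 * n \<and> t \<le> 2 * n \<and> act_over n a" if "(s, a, t) \<in> with_input n ?E" for s a t
    using that n(2) at1 unfolding with_input_def by (auto dest: 1) (auto dest: b)
  have 3: "\<exists>c. a = Got c" if "(s, Ask, t) \<in> with_input n ?E" "(t, a, t') \<in> with_input n ?E"
    for s t a t'
  proof -
    have st: "(s, Ask, t) \<in> ?E" using that(1) unfolding with_input_def by auto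
    \<comment> \<open>The chain leaves only states from \<open>n\<close> on, so it adds no edge to a
      state that waits for a letter.\<close>
    then have "t < n" using b by blast
    then have "(t, a, t') \<in> ?E" using that(2) unfolding with_input_def by auto
    then show ?thesis
      using st program_edges_facts(2)[of K p] by (meson disciplinedD)
  qed
  have "finite (with_input n ?E)" by (simp add: with_input_def program_edges_facts(1))
  then show ?thesis using 2 3 unfolding is_qmachine_def by blast
qed

lemma deterministic_with_input:
  assumes n: "bounded_by n (program_edges K p)"
  shows "deterministic (with_input n (program_edges K p))"
proof -
  have "deterministic {(n, Put 3, at 1 0)}"
    "deterministic ((\<lambda>i. (n + i + 1, Put 2, n + i)) ` {..<n})"
    by (auto simp: deterministic_def)
  then show ?thesis
    unfolding with_input_def
    by (intro deterministic_Un program_edges_facts(3))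
      (use n in \<open>force simp: bounded_by_def\<close>)+
qed

lemma count_list_replicate: "count_list (replicate n x) y = (if x = y then n else 0)"
  by (induction n) auto

text \<open>Register 1 starts at 1 because of the letter 3 put at the end of the loading chain. The
  final decrement of register 1 leads to state 0 or to a dead state; in the second case uniqueness
  of the run shows that 0 is never entered.\<close>

lemma halting_with_input:
  assumes n: "bounded_by n (program_edges K p)" "3 \<le> n"
    and run: "exec p ((\<lambda>_. 0)(0 := n, 1 := 1)) \<sigma>'" and K: "regs p \<subseteq> {..<K}" "2 \<le> K"
  shows "(\<exists>x w. (qstep (with_input n (program_edges K p)))\<^sup>*\<^sup>* (2 * n, 1, []) (0, x, w)) \<longleftrightarrow>
    \<sigma>' 1 = 0"
proof -
  let ?P = "program_edges K p" and ?L = "1 + locs p"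
  let ?E = "with_input n ?P"
  have load: "(qstep ?E)\<^sup>*\<^sup>* (n + i, 1, w) (n, 1, w @ replicate i 2)" if "i \<le> n" for i w
    using that
  proof (induction i arbitrary: w)
    case (Suc i)
    have "(n + Suc i, Put 2, n + i) \<in> ?E" using Suc.prems by (auto simp: with_input_def)
    then have "qstep ?E (n + Suc i, 1, w) (n + i, 1, w @ [2])" by (rule qstep.put)
    then show ?case using Suc.IH[of "w @ [2]"] Suc.prems
      by (auto intro: converse_rtranclp_into_rtranclp)
  qed auto
  have "(qstep ?E)\<^sup>*\<^sup>* (2 * n, 1, []) (n, 1, replicate n 2)"
    using load[of n "[]"] by (simp add: mult_2)
  also have "qstep ?E (n, 1, replicate n 2) (at 1 0, 1, replicate n 2 @ [3])"
    by (intro qstep.put) (auto simp: with_input_def)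
  finally (rtranclp.rtrancl_into_rtrancl)
  have start: "(qstep ?E)\<^sup>*\<^sup>* (2 * n, 1, []) (at 1 0, 1, replicate n 2 @ [3])" .
  have "holds_regs K ((\<lambda>_. 0)(0 := n, 1 := 1)) (replicate n 2 @ [3])"
    using K(2) by (auto simp: holds_regs_def count_list_replicate)
  then obtain x w where "(qstep ?E)\<^sup>*\<^sup>* (at 1 0, 1, replicate n 2 @ [3]) (at ?L 0, x, w)"
      and w: "holds_regs K \<sigma>' w"
    using qstep_exec[OF run _ K(1), of 1 ?E "replicate n 2 @ [3]" "(at 1 0, 1, replicate n 2 @ [3])" 1]
    by (force simp: with_input_def program_edges_def)
  moreover have dec: "decrement_edges K 1 ?L (2 + locs p) 0 \<subseteq> ?E"
    by (auto simp: with_input_def program_edges_def)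
  then have "qstep ?E (at ?L 0, x, w) (at ?L 1, x, w @ [1])"
    by (intro qstep.put) (auto simp: decrement_edges_def)
  ultimately have run: "(qstep ?E)\<^sup>*\<^sup>* (2 * n, 1, []) (at ?L 1, x, w @ [1])"
    using start by (meson rtranclp_trans rtranclp.rtrancl_into_rtrancl)
  have zero: "at l k = 0 \<longleftrightarrow> l = 0 \<and> k = 0" for l k
    using prod_encode_eq[of "(l, k)" "(0, 0)"] by (simp add: prod_encode_def)
  show ?thesis
  proof (cases "\<sigma>' 1")
    case 0
    then have "(qstep ?E)\<^sup>*\<^sup>* (at ?L 1, x, w @ [1]) (at 0 0, 1, w)"
      using qstep_decrement(1)[OF dec _ w] K(2) by simp
    then have "(qstep ?E)\<^sup>*\<^sup>* (2 * n, 1, []) (0, 1, w)" using run zero[of 0 0] by simp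
    then show ?thesis using 0 by blast
  next
    case (Suc m)
    let ?stuck = "at (2 + locs p) 0"
    obtain w' where "(qstep ?E)\<^sup>*\<^sup>* (at ?L 1, x, w @ [1]) (?stuck, 1, w')"
      using qstep_decrement(2)[OF dec _ w] K(2) Suc by auto
    then have stuck: "(qstep ?E)\<^sup>*\<^sup>* (2 * n, 1, []) (?stuck, 1, w')" using run by simp
    have "(at ?L 4, Got 1, ?stuck) \<in> ?P" by (auto simp: program_edges_def decrement_edges_def)
    \<comment> \<open>Being the target of a program edge, the dead state lies below the chain; its
      location is past those of all program edges.\<close>
    then have "?stuck < n" using n(1) by (auto simp: bounded_by_def)
    then have no_out: "(?stuck, a, t) \<notin> ?E" "(0, a, t) \<notin> ?E" for a t
      using n(2) zero by (auto simp: with_input_def dest!: program_edges_facts(5))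
    have ne: "?stuck \<noteq> 0" using zero by simp
    have "\<not> (qstep ?E)\<^sup>*\<^sup>* (2 * n, 1, []) (0, x', w'')" for x' w''
    proof
      assume "(qstep ?E)\<^sup>*\<^sup>* (2 * n, 1, []) (0, x', w'')"
      \<comment> \<open>Of the two configurations one would reach the other, but neither control
        state can be left.\<close>
      then have "(qstep ?E)\<^sup>*\<^sup>* (0, x', w'') (?stuck, 1, w') \<or>
          (qstep ?E)\<^sup>*\<^sup>* (?stuck, 1, w') (0, x', w'')"
        by (rule qsteps_linear[OF is_qmachine_with_input[OF n] deterministic_with_input[OF n(1)] _ stuck])
          simp
      then show False
        using qsteps_stuck no_out ne by metis
    qed
    then show ?thesis using Suc by simp
  qed
qed

section \<open>Computability of the code of an instance\<close>

text \<open>Restricting to total functions of fixed arity gives closure lemmas that follow the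
  syntax of an arithmetic expression, as needed for \<open>self_instance_code\<close>.\<close>

definition computable :: "nat \<Rightarrow> (nat list \<Rightarrow> nat) \<Rightarrow> bool" where
  "computable k f \<longleftrightarrow> (\<exists>r. \<forall>xs. length xs = k \<longrightarrow> rec_eval r xs (f xs))"

lemma computable_cong:
  assumes "computable k f" "\<And>xs. length xs = k \<Longrightarrow> f xs = g xs"
  shows "computable k g"
  using assms unfolding computable_def by metis

lemma computable_Comp:
  assumes h: "computable (length fs) h" and fs: "\<And>f. f \<in> set fs \<Longrightarrow> computable k f"
  shows "computable k (\<lambda>xs. h (map (\<lambda>f. f xs) fs))"
proof -
  obtain rh where rh: "\<And>ys. length ys = length fs \<Longrightarrow> rec_eval rh ys (h ys)"
    using h unfolding computable_def by blast
  obtain R where R: "\<And>f xs. f \<in> set fs \<Longrightarrow> length xs = k \<Longrightarrow> rec_eval (R f) xs (f xs)"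
    using fs unfolding computable_def by metis
  have "rec_eval (Comp rh (map R fs)) xs (h (map (\<lambda>f. f xs) fs))" if "length xs = k" for xs
    by (rule rec_eval.intros(4)[where ys = "map (\<lambda>f. f xs) fs"]) (use that rh R in auto)
  then show ?thesis unfolding computable_def by blast
qed

lemma computable_nth: "i < k \<Longrightarrow> computable k (\<lambda>xs. xs ! i)"
  unfolding computable_def by (metis rec_eval.intros(3))

lemma computable_Suc:
  assumes "computable k f"
  shows "computable k (\<lambda>xs. Suc (f xs))"
proof -
  have "computable 1 (\<lambda>ys. Suc (ys ! 0))"
    unfolding computable_def
    by (rule exI[of _ Succ]) (auto simp: length_Suc_conv intro: rec_eval.intros(2))
  then show ?thesis using computable_Comp[of "[f]" "\<lambda>ys. Suc (ys ! 0)" k] assms by simp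
qed

lemma computable_const: "computable k (\<lambda>_. c)"
proof (induction c)
  case 0
  show ?case unfolding computable_def by (meson rec_eval.intros(1))
qed (rule computable_Suc)

text \<open>\<open>PrimRec\<close> recurses on its first argument. A computed bound
  \<open>n xs\<close> is placed there by composition, with projections passing on the
  parameters.\<close>

lemma computable_rec:
  assumes g: "computable k g" and n: "computable k n"
    and h: "computable (Suc (Suc k)) (\<lambda>ys. h (ys ! 0) (ys ! 1) (drop 2 ys))"
  shows "computable k (\<lambda>xs. rec_nat (g xs) (\<lambda>i y. h i y xs) (n xs))"
proof -
  obtain rg where rg: "\<And>xs. length xs = k \<Longrightarrow> rec_eval rg xs (g xs)"
    using g unfolding computable_def by blast
  obtain rh where rh: "\<And>ys. length ys = Suc (Suc k) \<Longrightarrow> rec_eval rh ys (h (ys ! 0) (ys ! 1) (drop 2 ys))"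
    using h unfolding computable_def by blast
  let ?F = "\<lambda>xs. rec_nat (g xs) (\<lambda>i y. h i y xs)"
  have "rec_eval (PrimRec rg rh) (m # xs) (?F xs m)" if "length xs = k" for m xs
  proof (induction m)
    case 0
    show ?case using that by (auto intro: rec_eval.intros(5) rg)
  next
    case (Suc m)
    have "rec_eval rh (m # ?F xs m # xs) (?F xs (Suc m))"
      using rh[of "m # ?F xs m # xs"] that by simp
    then show ?case using Suc by (rule_tac rec_eval.intros(6))
  qed
  then have "rec_eval (PrimRec rg rh) ys (?F (tl ys) (hd ys))" if "length ys = Suc k" for ys
    using that by (cases ys) auto
  then have *: "computable (Suc k) (\<lambda>ys. ?F (tl ys) (hd ys))"
    unfolding computable_def by blast
  let ?ps = "n # map (\<lambda>i xs. xs ! i) [0..<k]"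
  have "computable k (\<lambda>xs. ?F (tl (map (\<lambda>f. f xs) ?ps)) (hd (map (\<lambda>f. f xs) ?ps)))"
    by (rule computable_Comp) (use * n in \<open>auto intro: computable_nth\<close>)
  then show ?thesis
    by (rule computable_cong) (simp add: comp_def, metis map_nth)
qed

lemma computable_drop:
  assumes "computable k f"
  shows "computable (m + k) (\<lambda>ys. f (drop m ys))"
proof -
  let ?ps = "map (\<lambda>i xs. xs ! (m + i)) [0..<k]"
  have "computable (m + k) (\<lambda>xs. f (map (\<lambda>f. f xs) ?ps))"
    by (rule computable_Comp) (use assms in \<open>auto intro: computable_nth\<close>)
  then show ?thesis
    by (rule computable_cong) (auto simp: comp_def intro!: arg_cong[of _ _ f] nth_equalityI)
qed

lemma computable_add:
  assumes "computable k f" "computable k g"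
  shows "computable k (\<lambda>xs. f xs + g xs)"
proof -
  have "computable k (\<lambda>xs. rec_nat (f xs) (\<lambda>i y. Suc y) (g xs))"
    using assms by (intro computable_rec computable_Suc computable_nth) auto
  moreover have "rec_nat a (\<lambda>i y. Suc y) b = a + b" for a b by (induction b) auto
  ultimately show ?thesis by simp
qed

lemma computable_sum:
  assumes f: "computable (Suc k) (\<lambda>ys. f (hd ys) (tl ys))" and n: "computable k n"
  shows "computable k (\<lambda>xs. \<Sum>i<n xs. f i xs)"
proof -
  let ?ps = "(\<lambda>ys. ys ! 0) # map (\<lambda>i ys. ys ! (i + 2)) [0..<k]"
  have "computable (Suc (Suc k)) (\<lambda>ys. f (hd (map (\<lambda>f. f ys) ?ps)) (tl (map (\<lambda>f. f ys) ?ps)))"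
    by (rule computable_Comp) (use f in \<open>auto intro: computable_nth\<close>)
  then have "computable (Suc (Suc k)) (\<lambda>ys. f (ys ! 0) (drop 2 ys))"
    by (rule computable_cong) (auto simp: comp_def intro!: arg_cong[of _ _ "f _"] nth_equalityI)
  then have "computable k (\<lambda>xs. rec_nat 0 (\<lambda>i y. y + f i xs) (n xs))"
    using n by (intro computable_rec computable_add computable_nth computable_const) auto
  moreover have "rec_nat 0 (\<lambda>i y. y + f i xs) m = (\<Sum>i<m. f i xs)" for m xs
    by (induction m) auto
  ultimately show ?thesis by simp
qed

lemma computable_mult:
  assumes "computable k f" "computable k g"
  shows "computable k (\<lambda>xs. f xs * g xs)"
proof -
  have "computable k (\<lambda>xs. \<Sum>i<f xs. g xs)"
    using computable_drop[OF assms(2), of 1] assms(1)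
    by (intro computable_sum) (simp_all add: drop_Suc)
  then show ?thesis by simp
qed

lemma computable_power2:
  assumes "computable k f"
  shows "computable k (\<lambda>xs. 2 ^ f xs)"
proof -
  have "computable k (\<lambda>xs. rec_nat 1 (\<lambda>i y. y + y) (f xs))"
    using assms by (intro computable_rec computable_add computable_nth computable_const) auto
  moreover have "rec_nat 1 (\<lambda>i y. y + y) m = (2::nat) ^ m" for m by (induction m) auto
  ultimately show ?thesis by simp
qed

lemma computable_prod_encode:
  assumes "computable k f" "computable k g"
  shows "computable k (\<lambda>xs. prod_encode (f xs, g xs))"
proof -
  have "computable k (\<lambda>xs. rec_nat 0 (\<lambda>i y. y + Suc i) (f xs + g xs))"
    using assms by (intro computable_rec computable_add computable_Suc computable_nth computable_const) auto
  moreover have "rec_nat 0 (\<lambda>i y. y + Suc i) m = triangle m" for m by (induction m) auto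
  ultimately show ?thesis
    using assms(1) by (simp add: prod_encode_def computable_add)
qed

lemma computable_list_encode_Nil: "computable k (\<lambda>xs. list_encode [])"
  by (rule computable_const)

lemma computable_list_encode_Cons:
  assumes "computable k f" "computable k (\<lambda>xs. list_encode (g xs))"
  shows "computable k (\<lambda>xs. list_encode (f xs # g xs))"
  using computable_Suc[OF computable_prod_encode[OF assms]] by simp

lemma computable_hd: "computable (Suc k) hd"
  by (rule computable_cong[OF computable_nth[of 0]]) (auto simp: length_Suc_conv)

lemma computable_tl_nth: "i < k \<Longrightarrow> computable (Suc k) (\<lambda>ys. tl ys ! i)"
  by (rule computable_cong[OF computable_nth[of "Suc i"]]) (auto simp: length_Suc_conv)

section \<open>Diagonalisation\<close>

lemma less_list_encode: "x \<in> set xs \<Longrightarrow> x < list_encode xs"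
proof (induction xs)
  case (Cons y xs)
  then show ?case
    using le_prod_encode_1[of y "list_encode xs"] le_prod_encode_2[of "list_encode xs" y] by auto
qed simp

lemma less_set_encode:
  assumes "finite S" "x \<in> S"
  shows "x < set_encode S"
proof -
  have "2 ^ x \<le> set_encode S"
    unfolding set_encode_def using assms by (intro member_le_sum) auto
  then show ?thesis using less_exp[of x] by linarith
qed

lemma set_encode_insert_disjoint:
  "finite T \<Longrightarrow> x \<notin> T \<Longrightarrow> set_encode T = m \<Longrightarrow> set_encode (insert x T) = 2 ^ x + m"
  by (simp add: set_encode_def)

lemma set_encode_Un_disjoint:
  "finite S \<Longrightarrow> finite T \<Longrightarrow> S \<inter> T = {} \<Longrightarrow> set_encode S = m \<Longrightarrow> set_encode T = n \<Longrightarrow>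
    set_encode (S \<union> T) = m + n"
  by (simp add: set_encode_def sum.union_disjoint)

lemma set_encode_image:
  "inj_on f S \<Longrightarrow> set_encode (f ` S) = (\<Sum>i\<in>S. 2 ^ f i)"
  by (simp add: set_encode_def sum.reindex)

lemma set_encode_image_Un:
  assumes "inj_on f S" "finite S" "finite T" "f ` S \<inter> T = {}" "set_encode T = m"
  shows "set_encode (f ` S \<union> T) = (\<Sum>i\<in>S. 2 ^ f i) + m"
  using assms by (simp add: set_encode_Un_disjoint set_encode_image)

text \<open>This is exactly the share of \<open>E\<close> in the transition component of
  \<open>qdas_code\<close>. As \<open>set_encode\<close> is additive on disjoint sets, the number
  reappears there as a plain summand.\<close>

definition edges_code :: "qmachine \<Rightarrow> nat" where
  "edges_code E =
     set_encode ((\<lambda>(s, a, t). list_encode [0, 4 * s, action_code (qact_action a), 4 * t]) ` E)"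

lemma less_edges_code:
  assumes "finite E" "(s, a, t) \<in> E"
  shows "4 * s < edges_code E" "action_code (qact_action a) < edges_code E" "4 * t < edges_code E"
proof -
  have "list_encode [0, 4 * s, action_code (qact_action a), 4 * t] < edges_code E"
    unfolding edges_code_def using assms by (intro less_set_encode) force+
  then show "4 * s < edges_code E" "action_code (qact_action a) < edges_code E"
      "4 * t < edges_code E"
    using less_list_encode[of _ "[0, 4 * s, action_code (qact_action a), 4 * t]"]
    by (auto intro: less_trans simp del: list_encode.simps)
qed

text \<open>A code exceeds every number occurring in it, so one number can be the code of the
  program, the number of letters and the first state of the loading chain.\<close>

lemma bounded_by_edges_code:
  assumes "finite E"
  shows "bounded_by (edges_code E) E"
proof -
  have "c < action_code (qact_action a)" if "a = Put c \<or> a = Got c" for a c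
  proof -
    \<comment> \<open>The list \<open>[0, 0, c]\<close> codes both the dispatch of \<open>c\<close>
      to queue 0 and the atom \<open>Eq 0 c\<close>, which a guard wraps once more.\<close>
    have "c < list_encode [0, 0, c]" "list_encode [0, 0, c] < list_encode [2, list_encode [0, 0, c]]"
      by (intro less_list_encode; simp del: list_encode.simps)+
    then show ?thesis using that by (auto simp del: list_encode.simps)
  qed
  then have "s < edges_code E \<and> t < edges_code E \<and> (\<forall>c. a = Put c \<or> a = Got c \<longrightarrow> c < edges_code E)"
    if "(s, a, t) \<in> E" for s a t
    using less_edges_code[OF assms that] by (auto intro: less_trans)
  then show ?thesis unfolding bounded_by_def by blast
qed

text \<open>
  Numbering the states, letters and loading chain of \<open>qdas_of\<close> by the code \<open>n\<close> of the program
  itself makes the code of the whole instance a function of \<open>n\<close> alone.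
\<close>

definition self_instance :: "qmachine \<Rightarrow> (nat, nat, nat, nat, nat) qdas \<times> (nat \<Rightarrow> nat)" where
  "self_instance E =
     (let n = edges_code E in (qdas_of (2 * n) n (2 * n) (with_input n E), halting_target))"

text \<open>The entries follow \<open>qdas_code\<close>, with one sum for each regular family. The
  lone summand \<open>n\<close> stands for the transitions of the program, which never have to be
  decoded. Indices are shifted by \<open>Suc\<close> because block 0 is main.\<close>

definition self_instance_code :: "nat \<Rightarrow> nat" where
  "self_instance_code n = list_encode
     [list_encode
       [\<Sum>i<Suc n. 2 ^ i, 1, 1, 0, 1, \<Sum>i<Suc n. 2 ^ i, 0,
        (\<Sum>i<Suc (2 * n). 2 ^ list_encode [0, 4 * i]) +
          ((\<Sum>c<n. 2 ^ list_encode [Suc c, 4 * Suc c + 1]) +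
          ((\<Sum>c<n. 2 ^ list_encode [Suc c, 4 * Suc c + 2]) +
          (\<Sum>c<n. 2 ^ list_encode [Suc c, 4 * Suc c + 3]))),
        2 ^ list_encode [0, 4 * (2 * n), 0] +
          (\<Sum>c<n. 2 ^ list_encode [Suc c, 4 * Suc c + 1, 4 * Suc c + 3]),
        n + (2 ^ list_encode [0, 4 * n, list_encode [0, 0, 3], 4 * at 1 0] +
          ((\<Sum>i<n. 2 ^ list_encode [0, 4 * (n + i + 1), list_encode [0, 0, 2], 4 * (n + i)]) +
          ((\<Sum>c<n. 2 ^ list_encode [Suc c, 4 * Suc c + 1,
              list_encode [2, list_encode [0, 0, 0]], 4 * Suc c + 2]) +
          (\<Sum>c<n. 2 ^ list_encode [Suc c, 4 * Suc c + 2,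
              list_encode [3, 0, Suc c], 4 * Suc c + 3]))))],
      2 ^ list_encode [0, 1] +
        ((\<Sum>i<2 * n. 2 ^ list_encode [4 * Suc i, 0]) +
        ((\<Sum>c<n. 2 ^ list_encode [4 * Suc c + 1, 0]) +
        ((\<Sum>c<n. 2 ^ list_encode [4 * Suc c + 2, 0]) +
        (\<Sum>c<n. 2 ^ list_encode [4 * Suc c + 3, 0]))))]"

lemma computable_self_instance_code: "computable 1 (\<lambda>xs. self_instance_code (xs ! 0))"
  unfolding self_instance_code_def
  by (intro computable_list_encode_Cons computable_list_encode_Nil computable_add computable_sum
      computable_power2 computable_mult computable_Suc computable_const computable_hd
      computable_tl_nth computable_nth) simp_all

text \<open>Every coded set is split into disjoint injective images of intervals, on which
  \<open>set_encode\<close> becomes a sum; only the program's own transitions are kept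
  whole.\<close>

lemma instance_code_self_instance:
  fixes E
  defines "n \<equiv> edges_code E"
  assumes E: "finite E"
  shows "instance_code (self_instance E) = self_instance_code n"
proof -
  let ?A = "qdas_of (2 * n) n (2 * n) (with_input n E)"
  note [simp del] = list_encode.simps
  note [simp] = list_encode_eq
  have blocks: "{..n} = insert 0 (Suc ` {..<n})"
    by (simp add: lessThan_Suc_atMost[symmetric] lessThan_Suc_eq_insert_0)
  have less_n: "s < n" if "(s, a, t) \<in> E" for s a t
    using less_edges_code(1)[OF E that] unfolding n_def by linarith
  have upto: "set_encode {..n} = (\<Sum>i<Suc n. 2 ^ i)"
    by (simp add: set_encode_def lessThan_Suc_atMost)
  have main_states: "{4 * i | i. i \<le> 2 * n} = (\<lambda>i. 4 * i) ` {..<Suc (2 * n)}"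
    by (auto simp: less_Suc_eq_le)
  have "{list_encode [\<gamma>, s] | \<gamma> s. \<gamma> \<in> Blocks ?A \<and> s \<in> States ?A \<gamma>} =
      (\<Union>\<gamma>\<in>{..n}. (\<lambda>s. list_encode [\<gamma>, s]) ` States ?A \<gamma>)"
    by auto
  also have "\<dots> = (\<lambda>i. list_encode [0, 4 * i]) ` {..<Suc (2 * n)} \<union>
      ((\<lambda>c. list_encode [Suc c, 4 * Suc c + 1]) ` {..<n} \<union>
      ((\<lambda>c. list_encode [Suc c, 4 * Suc c + 2]) ` {..<n} \<union>
      (\<lambda>c. list_encode [Suc c, 4 * Suc c + 3]) ` {..<n}))"
    unfolding blocks UN_insert qdas_of_main main_states by (auto simp del: mult_Suc_right)
  finally have states: "set_encode {list_encode [\<gamma>, s] | \<gamma> s. \<gamma> \<in> Blocks ?A \<and> s \<in> States ?A \<gamma>} =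
      (\<Sum>i<Suc (2 * n). 2 ^ list_encode [0, 4 * i]) +
          ((\<Sum>c<n. 2 ^ list_encode [Suc c, 4 * Suc c + 1]) +
          ((\<Sum>c<n. 2 ^ list_encode [Suc c, 4 * Suc c + 2]) +
          (\<Sum>c<n. 2 ^ list_encode [Suc c, 4 * Suc c + 3])))"
    by (simp only:) (intro set_encode_image_Un set_encode_image; auto simp: inj_on_def simp del: mult_Suc_right)
  have "{list_encode [\<gamma>, sinit ?A \<gamma>, sfinal ?A \<gamma>] | \<gamma>. \<gamma> \<in> Blocks ?A} =
      (\<lambda>\<gamma>. list_encode [\<gamma>, sinit ?A \<gamma>, sfinal ?A \<gamma>]) ` {..n}"
    by auto
  also have "\<dots> = insert (list_encode [0, 4 * (2 * n), 0])
      ((\<lambda>c. list_encode [Suc c, 4 * Suc c + 1, 4 * Suc c + 3]) ` {..<n})"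
    unfolding blocks by (auto simp: image_image simp del: mult_Suc_right)
  finally have ends: "set_encode {list_encode [\<gamma>, sinit ?A \<gamma>, sfinal ?A \<gamma>] | \<gamma>. \<gamma> \<in> Blocks ?A} =
      2 ^ list_encode [0, 4 * (2 * n), 0] +
        (\<Sum>c<n. 2 ^ list_encode [Suc c, 4 * Suc c + 1, 4 * Suc c + 3])"
    by (simp only:) (intro set_encode_insert_disjoint set_encode_image;
      auto simp: inj_on_def simp del: mult_Suc_right)
  let ?base = "(\<lambda>(s, a, t). list_encode [0, 4 * s, action_code (qact_action a), 4 * t]) ` E"
  let ?added = "insert (list_encode [0, 4 * n, list_encode [0, 0, 3], 4 * at 1 0])
      ((\<lambda>i. list_encode [0, 4 * (n + i + 1), list_encode [0, 0, 2], 4 * (n + i)]) ` {..<n} \<union>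
      ((\<lambda>c. list_encode [Suc c, 4 * Suc c + 1,
              list_encode [2, list_encode [0, 0, 0]], 4 * Suc c + 2]) ` {..<n} \<union>
      (\<lambda>c. list_encode [Suc c, 4 * Suc c + 2, list_encode [3, 0, Suc c], 4 * Suc c + 3]) ` {..<n}))"
  have base: "set_encode ?base = n" by (simp add: n_def edges_code_def)
  have added: "set_encode ?added =
      2 ^ list_encode [0, 4 * n, list_encode [0, 0, 3], 4 * at 1 0] +
          ((\<Sum>i<n. 2 ^ list_encode [0, 4 * (n + i + 1), list_encode [0, 0, 2], 4 * (n + i)]) +
          ((\<Sum>c<n. 2 ^ list_encode [Suc c, 4 * Suc c + 1,
              list_encode [2, list_encode [0, 0, 0]], 4 * Suc c + 2]) +
          (\<Sum>c<n. 2 ^ list_encode [Suc c, 4 * Suc c + 2,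
              list_encode [3, 0, Suc c], 4 * Suc c + 3])))"
    by (intro set_encode_insert_disjoint set_encode_image_Un set_encode_image;
      auto simp: inj_on_def simp del: mult_Suc_right)
  \<comment> \<open>Program edges start below \<open>4 * n\<close>, chain edges at
    \<open>4 * n\<close> or above, and the remaining transitions belong to nonzero blocks.\<close>
  have "?base \<inter> ?added = {}" by (auto dest: less_n)
  then have base_added: "set_encode (?base \<union> ?added) = n + set_encode ?added"
    by (intro set_encode_Un_disjoint base) (use E in auto)
  have "{list_encode [\<gamma>, s, action_code a, s'] | \<gamma> s a s'. \<gamma> \<in> Blocks ?A \<and> (s, a, s') \<in> Delta ?A \<gamma>} =
      (\<Union>\<gamma>\<in>{..n}. (\<lambda>(s, a, t). list_encode [\<gamma>, s, action_code a, t]) ` Delta ?A \<gamma>)"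
    by force
  also have "\<dots> =
      (\<lambda>(s, a, t). list_encode [0, 4 * s, action_code (qact_action a), 4 * t]) ` with_input n E \<union>
      (\<Union>c<n. {list_encode [Suc c, 4 * Suc c + 1, list_encode [2, list_encode [0, 0, 0]], 4 * Suc c + 2],
         list_encode [Suc c, 4 * Suc c + 2, list_encode [3, 0, Suc c], 4 * Suc c + 3]})"
    unfolding blocks UN_insert qdas_of_main
    by (rule arg_cong2[of _ _ _ _ "(\<union>)"]) (force, simp del: mult_Suc_right)
  also have "\<dots> = ?base \<union> ?added"
    unfolding with_input_def image_Un image_insert image_image prod.case qact_action.simps
    by (auto simp del: mult_Suc_right)
  finally have deltas: "set_encode {list_encode [\<gamma>, s, action_code a, s'] | \<gamma> s a s'.
        \<gamma> \<in> Blocks ?A \<and> (s, a, s') \<in> Delta ?A \<gamma>} =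
      n + (2 ^ list_encode [0, 4 * n, list_encode [0, 0, 3], 4 * at 1 0] +
          ((\<Sum>i<n. 2 ^ list_encode [0, 4 * (n + i + 1), list_encode [0, 0, 2], 4 * (n + i)]) +
          ((\<Sum>c<n. 2 ^ list_encode [Suc c, 4 * Suc c + 1,
              list_encode [2, list_encode [0, 0, 0]], 4 * Suc c + 2]) +
          (\<Sum>c<n. 2 ^ list_encode [Suc c, 4 * Suc c + 2,
              list_encode [3, 0, Suc c], 4 * Suc c + 3]))))"
    by (simp only: base_added added)
  have all_states: "all_states ?A = insert 0 ((\<lambda>i. 4 * Suc i) ` {..<2 * n} \<union>
      ((\<lambda>c. 4 * Suc c + 1) ` {..<n} \<union>
      ((\<lambda>c. 4 * Suc c + 2) ` {..<n} \<union> (\<lambda>c. 4 * Suc c + 3) ` {..<n})))"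
    unfolding all_states_def qdas_of_simps blocks UN_insert qdas_of_main main_states
      lessThan_Suc_eq_insert_0
    by (auto simp del: mult_Suc_right)
  have "{list_encode [s, halting_target s] | s. s \<in> all_states ?A} =
      (\<lambda>s. list_encode [s, halting_target s]) ` all_states ?A"
    by blast
  also have "\<dots> =
      insert (list_encode [0, 1]) ((\<lambda>i. list_encode [4 * Suc i, 0]) ` {..<2 * n} \<union>
      ((\<lambda>c. list_encode [4 * Suc c + 1, 0]) ` {..<n} \<union>
      ((\<lambda>c. list_encode [4 * Suc c + 2, 0]) ` {..<n} \<union>
      (\<lambda>c. list_encode [4 * Suc c + 3, 0]) ` {..<n})))"
    unfolding all_states image_insert image_Un image_image
    by (simp add: halting_target_def)
  finally have fvals: "set_encode {list_encode [s, halting_target s] | s. s \<in> all_states ?A} =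
      2 ^ list_encode [0, 1] +
        ((\<Sum>i<2 * n. 2 ^ list_encode [4 * Suc i, 0]) +
        ((\<Sum>c<n. 2 ^ list_encode [4 * Suc c + 1, 0]) +
        ((\<Sum>c<n. 2 ^ list_encode [4 * Suc c + 2, 0]) +
        (\<Sum>c<n. 2 ^ list_encode [4 * Suc c + 3, 0]))))"
    by (simp only:) (intro set_encode_insert_disjoint set_encode_image_Un set_encode_image;
      auto simp: inj_on_def simp del: mult_Suc_right; presburger)
  have "set_encode {0} = 1" "set_encode {} = 0" by (simp_all add: set_encode_def)
  then show ?thesis
    unfolding self_instance_def Let_def n_def[symmetric] instance_code_def qdas_code_def
      self_instance_code_def prod.case
    unfolding states ends deltas fvals
    unfolding qdas_of_simps upto
    by simp
qed

theorem theorem4: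
  shows "\<not> decidable instance_code
    {(A, f). is_qdas A \<and> asynchronous A \<and> SQID A \<noteq> {}}
    (\<lambda>(A, f). parikh_coverable A f)"
proof
  assume "decidable instance_code
    {(A, f). is_qdas A \<and> asynchronous A \<and> SQID A \<noteq> {}}
    (\<lambda>(A, f). parikh_coverable A f)"
  then obtain r where r: "\<And>A f. is_qdas A \<Longrightarrow> asynchronous A \<Longrightarrow> SQID A \<noteq> {} \<Longrightarrow>
      rec_eval r [instance_code (A, f)] (if parikh_coverable A f then 1 else 0)"
    unfolding decidable_def by fastforce
  obtain c where c: "\<And>xs. length xs = 1 \<Longrightarrow> rec_eval c xs (self_instance_code (xs ! 0))"
    using computable_self_instance_code unfolding computable_def by blast
  \<comment> \<open>Input in register 0, output in register 1, scratch space from 2 on. The program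
    does not mention \<open>n\<close>, so defining \<open>n\<close> from it is not circular.\<close>
  define p where "p = compile (Comp r [c]) [0] 1 2"
  obtain K0 where "regs p \<subseteq> {..<K0}"
    using finite_regs[of p] unfolding finite_nat_set_iff_bounded by blast
  then obtain K where K: "regs p \<subseteq> {..<K}" "2 \<le> K"
    by (meson lessThan_subset_iff max.cobounded1 max.cobounded2 order_trans)
  define E where "E = program_edges K p"
  define n where "n = edges_code E"
  define A where "A = qdas_of (2 * n) n (2 * n) (with_input n E)"
  have fin: "finite E" by (simp add: E_def program_edges_facts(1))
  have bounded: "bounded_by n E" unfolding n_def by (rule bounded_by_edges_code[OF fin])
  \<comment> \<open>Any edge bounds \<open>n\<close> from below by four times its source; this
    source is at least 1.\<close>
  have "(at (1 + locs p) 0, Put 1, at (1 + locs p) 1) \<in> E"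
    by (simp add: E_def program_edges_def decrement_edges_def)
  then have "4 * at (1 + locs p) 0 < n" unfolding n_def using less_edges_code(1)[OF fin] by blast
  moreover have "1 \<le> at (1 + locs p) 0" using le_prod_encode_1[of "1 + locs p" 0] by linarith
  ultimately have n3: "3 \<le> n" by linarith
  have machine: "is_qmachine (2 * n) n (with_input n E)"
    using is_qmachine_with_input bounded n3 unfolding E_def by blast
  define y :: nat where "y = (if parikh_coverable A halting_target then 1 else 0)"
  have "instance_code (A, halting_target) = self_instance_code n"
    using instance_code_self_instance[OF fin] unfolding A_def n_def self_instance_def Let_def .
  moreover have "rec_eval r [instance_code (A, halting_target)] y"
    unfolding y_def
    by (rule r) (use machine n3 in \<open>auto simp: A_def is_qdas_qdas_of asynchronous_qdas_of\<close>)
  ultimately have "rec_eval (Comp r [c]) [n] y"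
    using c[of "[n]"] by (intro rec_eval.intros(4)[of "[self_instance_code n]"]) auto
  then have "computes (compile (Comp r [c])) [n] y" by (rule computes_compile)
  then obtain \<sigma>' where \<sigma>': "exec p ((\<lambda>_. 0)(0 := n, 1 := 1)) \<sigma>'" "\<sigma>' 1 = y"
    unfolding p_def
    by (rule computesE[where \<sigma> = "(\<lambda>_. 0)(0 := n, 1 := 1)" and as = "[0]" and d = 1 and n = 2])
      (auto simp del: compile.simps)
  have "parikh_coverable A halting_target \<longleftrightarrow>
      (\<exists>x w. (qstep (with_input n E))\<^sup>*\<^sup>* (2 * n, 1, []) (0, x, w))"
    unfolding A_def by (rule parikh_coverable_iff_halting[OF machine]) simp
  \<comment> \<open>The machine halts exactly when the computed answer is 0, that is, when the
    instance is declared not coverable.\<close>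
  also have "\<dots> \<longleftrightarrow> y = 0"
    using halting_with_input[OF bounded[unfolded E_def] n3 \<sigma>'(1) K] \<sigma>'(2) by (simp add: E_def)
  finally show False by (simp add: y_def split: if_splits)
qed

end
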